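(* Fix positive reals $\alpha,\beta,M$. Then for each point $\xi^\star\in\mathbb{R}^2\setminus\Lambda_{\alpha,\beta}^{++}$ there exists a measure $\mu\in\mathrm{AC}(\Gamma_M)$ such that $\hat\mu=0$ on $\Lambda_{\alpha,\beta}^{++}$, while at the same time $\hat\mu(\xi^\star)\neq0$. Moreover, the same assertion holds with $\Lambda_{\alpha,\beta}^{++}$ replaced by $\Lambda_{\alpha,\beta}^{--}$. In terms of Zariski closures, $$\mathrm{zclos}_{\Gamma_M}(\Lambda_{\alpha,\beta}^{++})=\Lambda_{\alpha,\beta}^{++},\qquad \mathrm{zclos}_{\Gamma_M}(\Lambda_{\alpha,\beta}^{--})=\Lambda_{\alpha,\beta}^{--}.$$
   Context: $\mathbb{Z}_+=\{1,2,3,\ldots\}$, $\mathbb{Z}_-=\{-1,-2,-3,\ldots\}$, $\mathbb{Z}_{+,0}=\{0,1,2,\ldots\}$, $\mathbb{Z}_{-,0}=\{0,-1,-2,\ldots\}$, and $$\Lambda_{\alpha,\beta}^{++}=(\alpha\mathbb{Z}_{+,0}\times\{0\})\cup(\{0\}\times\beta\mathbb{Z}_+),\qquad \Lambda_{\alpha,\beta}^{--}=(\alpha\mathbb{Z}_{-,0}\times\{0\})\cup(\{0\}\times\beta\mathbb{Z}_-).$$ For a finite complex-valued Borel measure $\mu$ on $\mathbb{R}^2$, its Fourier transform is $\hat\mu(\xi)=\int_{\mathbb{R}^2}\mathrm{e}^{\mathrm{i}\pi\langle x,\xi\rangle}\,\mathrm{d}\mu(x)$, where $\langle x,\xi\rangle=x_1\xi_1+x_2\xi_2$.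 $\Gamma_M=\{x\in\mathbb{R}^2:\ x_1x_2=M^2/(4\pi^2)\}$, and $\mathrm{AC}(\Gamma_M)$ is the space of finite complex-valued Borel measures on $\mathbb{R}^2$ supported on $\Gamma_M$ that are absolutely continuous with respect to arc length measure on $\Gamma_M$. For $\Lambda\subset\mathbb{R}^2$, the Zariski closure $\mathrm{zclos}_{\Gamma_M}(\Lambda)$ is the set of all $\xi\in\mathbb{R}^2$ such that $\hat\mu(\xi)=0$ for every $\mu\in\mathrm{AC}(\Gamma_M)$ with $\hat\mu=0$ on $\Lambda$. *)

theory Defs
  imports "HOL-Analysis.Analysis"
begin

section \<open>Signed and complex measures as set functions\<close>

text \<open>
  A complex measure on the measurable space underlying \<open>N\<close> is a countably additive complex-valued
  set function; its values outside \<open>sets N\<close> are irrelevant. Being finite-valued, it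
  automatically has finite total variation.
\<close>

definition complex_measure :: "'a measure \<Rightarrow> ('a set \<Rightarrow> complex) \<Rightarrow> bool" where
  "complex_measure N \<nu> \<longleftrightarrow>
     \<nu> {} = 0 \<and>
     (\<forall>A :: nat \<Rightarrow> 'a set. range A \<subseteq> sets N \<longrightarrow> disjoint_family A \<longrightarrow>
        (\<lambda>n. \<nu> (A n)) sums \<nu> (\<Union>n. A n))"

text \<open>
  The positive part in the Jordan decomposition of a real signed measure:
  \<open>\<rho>\<^sup>+(A)\<close> is the supremum of \<open>\<rho>(B)\<close> over measurable \<open>B \<subseteq> A\<close>. Truncation by \<^const>\<open>ennreal\<close> is
  harmless because \<open>B = {}\<close> contributes 0. The negative part is the positive part of \<open>-\<rho>\<close>.
\<close>

definition pos_variation :: "'a measure \<Rightarrow> ('a set \<Rightarrow> real) \<Rightarrow> 'a measure" where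
  "pos_variation N \<rho> =
     measure_of (space N) (sets N) (\<lambda>A. SUP B \<in> {B \<in> sets N. B \<subseteq> A}. ennreal (\<rho> B))"

definition signed_integral :: "'a measure \<Rightarrow> ('a set \<Rightarrow> real) \<Rightarrow> ('a \<Rightarrow> complex) \<Rightarrow> complex" where
  "signed_integral N \<rho> f =
     integral\<^sup>L (pos_variation N \<rho>) f - integral\<^sup>L (pos_variation N (\<lambda>A. - \<rho> A)) f"

definition complex_measure_integral ::
    "'a measure \<Rightarrow> ('a set \<Rightarrow> complex) \<Rightarrow> ('a \<Rightarrow> complex) \<Rightarrow> complex" where
  "complex_measure_integral N \<nu> f =
     signed_integral N (\<lambda>A. Re (\<nu> A)) f + \<i> * signed_integral N (\<lambda>A. Im (\<nu> A)) f"


section \<open>Fourier transform of complex Borel measures on the plane\<close>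

definition fourier :: "((real \<times> real) set \<Rightarrow> complex) \<Rightarrow> real \<times> real \<Rightarrow> complex" where
  "fourier \<mu> \<xi> = complex_measure_integral borel \<mu> (\<lambda>x. exp (\<i> * of_real (pi * (x \<bullet> \<xi>))))"


section \<open>The hyperbola and its arc length measure\<close>

definition hyperbola :: "real \<Rightarrow> (real \<times> real) set" where
  "hyperbola M = {(x1, x2). x1 * x2 = M\<^sup>2 / (4 * pi\<^sup>2)}"

text \<open>
  Arc length measure of a \<open>C\<^sup>1\<close> curve \<open>\<gamma>\<close> that is injective on \<open>S\<close>: the image under \<open>\<gamma>\<close> of
  \<open>\<bar>\<gamma>'(t)\<bar> dt\<close> on \<open>S\<close>.
\<close>

definition arc_length_measure :: "(real \<Rightarrow> 'a::euclidean_space) \<Rightarrow> real set \<Rightarrow> 'a measure" where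
  "arc_length_measure \<gamma> S =
     distr (density lborel (\<lambda>t. ennreal (norm (vector_derivative \<gamma> (at t))) * indicator S t))
       borel \<gamma>"

definition hyperbola_param :: "real \<Rightarrow> real \<Rightarrow> real \<times> real" where
  "hyperbola_param M t = (t, M\<^sup>2 / (4 * pi\<^sup>2 * t))"

lemma hyperbola_param_bij:
  assumes "M > 0"
  shows "bij_betw (hyperbola_param M) (- {0}) (hyperbola M)"
proof (rule bij_betwI[where g = fst])
  show "hyperbola_param M \<in> - {0} \<rightarrow> hyperbola M"
    by (auto simp: hyperbola_param_def hyperbola_def)
  show "fst \<in> hyperbola M \<rightarrow> - {0}"
    using assms by (auto simp: hyperbola_def)
  show "fst (hyperbola_param M t) = t" for t
    by (simp add: hyperbola_param_def)
  fix x assume "x \<in> hyperbola M"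
  moreover from this have "fst x \<noteq> 0"
    using assms by (auto simp: hyperbola_def)
  ultimately show "hyperbola_param M (fst x) = x"
    by (auto simp: hyperbola_param_def hyperbola_def field_simps)
qed

definition hyperbola_arc_length :: "real \<Rightarrow> (real \<times> real) measure" where
  "hyperbola_arc_length M = arc_length_measure (hyperbola_param M) (- {0})"

text \<open>
  Vanishing on all Borel sets disjoint from the hyperbola says that the (closed) support of \<open>\<mu>\<close>
  lies in the hyperbola, since the latter is closed.
\<close>

definition AC_hyperbola :: "real \<Rightarrow> ((real \<times> real) set \<Rightarrow> complex) set" where
  "AC_hyperbola M =
     {\<mu>. complex_measure borel \<mu> \<and>
         (\<forall>A \<in> sets borel. A \<inter> hyperbola M = {} \<longrightarrow> \<mu> A = 0) \<and>
         (\<forall>A \<in> null_sets (hyperbola_arc_length M). \<mu> A = 0)}"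

definition zclos :: "real \<Rightarrow> (real \<times> real) set \<Rightarrow> (real \<times> real) set" where
  "zclos M \<Lambda> =
     {\<xi>. \<forall>\<mu> \<in> AC_hyperbola M. (\<forall>\<eta> \<in> \<Lambda>. fourier \<mu> \<eta> = 0) \<longrightarrow> fourier \<mu> \<xi> = 0}"


section \<open>The half lattice-crosses\<close>

definition Lambda_pp :: "real \<Rightarrow> real \<Rightarrow> (real \<times> real) set" where
  "Lambda_pp \<alpha> \<beta> =
     {\<alpha> * of_int j |j. j \<ge> 0} \<times> {0} \<union> {0} \<times> {\<beta> * of_int k |k. k \<ge> 1}"

definition Lambda_mm :: "real \<Rightarrow> real \<Rightarrow> (real \<times> real) set" where
  "Lambda_mm \<alpha> \<beta> =
     {\<alpha> * of_int j |j. j \<le> 0} \<times> {0} \<union> {0} \<times> {\<beta> * of_int k |k. k \<le> -1}"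

end

theory Submission
  imports Defs "HOL-Real_Asymp.Real_Asymp" "HOL-Probability.Sinc_Integral"
    "HOL-Complex_Analysis.Cauchy_Integral_Theorem"
begin

text \<open>
  With \<open>\<mu> = f(t) dt\<close> on the hyperbola, the Fourier transform becomes
  \<open>\<integral> f(t) exp (\<i> (A t + B / t)) dt\<close> with \<open>A = \<pi> \<xi>\<^sub>1\<close>, \<open>B = c \<pi> \<xi>\<^sub>2\<close>, \<open>c = M\<^sup>2 / (4 \<pi>\<^sup>2)\<close>. Let \<open>F\<close> be of Hardy class in the
  lower half-plane and \<open>f(t) = F(t + p) - F(t)\<close> with \<open>p = 2 / \<alpha>\<close>. The periodicity of
  \<open>exp (\<i> \<pi> \<alpha> j t)\<close> kills the frequencies \<open>(\<alpha> j, 0)\<close>, and since \<open>exp (\<i> b / t)\<close> is bounded and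
  holomorphic in the lower half-plane for \<open>b \<ge> 0\<close>, Cauchy's theorem kills all \<open>(0, \<eta>)\<close> with
  \<open>\<eta> \<ge> 0\<close>. If \<open>\<xi>\<^sub>2 < 0\<close>, or if \<open>\<xi>\<^sub>1 > 0\<close>, \<open>\<xi>\<^sub>2 \<ge> 0\<close> and \<open>\<xi>\<close> is not in the cross, then
  \<open>F\<close> can be chosen so that the transform at \<open>\<xi>\<close> is \<open>\<plusminus> \<integral> K(t) exp (- \<i> \<delta> / t) dt\<close>, respectively
  \<open>\<integral> G(t) exp (\<i> \<delta> t) dt\<close>, with \<open>K\<close>, \<open>G\<close> fixed functions of Hardy class and \<open>\<delta> > 0\<close> at our disposal.
  If it vanished for all small \<open>\<delta>\<close>, then \<open>K\<close> (or \<open>G\<close>) would be orthogonal to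
  \<open>(2 - 2 cos (\<delta> / t))\<^sup>2\<close> (or \<open>(2 - 2 cos (\<delta> t))\<^sup>2\<close>), the opposite frequencies being killed by Cauchy's
  theorem; rescaling as \<open>\<delta> \<rightarrow> 0\<close> contradicts the nonzero leading coefficient of \<open>K\<close> at 0 (of \<open>G\<close> at
  infinity). The remaining frequencies follow from the substitution \<open>t \<mapsto> c / t\<close>, which swaps the axes,
  and \<open>t \<mapsto> - t\<close> exchanges the two crosses.
\<close>

section \<open>Integrals of Hardy class functions\<close>

lemma integrable_inverse_one_plus_square: "integrable lborel (\<lambda>t::real. 1 / (1 + t\<^sup>2))"
  using integrable_inverse_1_plus_square by (simp add: set_integrable_def inverse_eq_divide)

text \<open>A weighted class of boundary values from the lower half-plane. Finitely many
  discontinuities on the real line are allowed because of factors \<open>exp (\<i> * b / (z - q))\<close> with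
  real \<open>q\<close>; at \<open>z = q\<close> these take the junk value 1, which respects all bounds.\<close>

definition hardy_lower :: "(complex \<Rightarrow> complex) \<Rightarrow> bool" where
  "hardy_lower F \<longleftrightarrow> F holomorphic_on {z. Im z < 0} \<and>
     (\<exists>C. \<forall>z. Im z \<le> 0 \<longrightarrow> norm (F z) \<le> C / (norm (z - \<i>))\<^sup>2) \<and>
     finite {t. \<not> isCont F (complex_of_real t)}"

lemma finite_discontinuities_measurable:
  fixes F :: "complex \<Rightarrow> complex"
  assumes "finite {t. \<not> isCont F (complex_of_real t)}"
  shows "(\<lambda>t. F (complex_of_real t)) \<in> borel_measurable borel"
proof (rule borel_measurable_continuous_countable_exceptions)
  show "countable {t. \<not> isCont F (complex_of_real t)}"
    using assms by (rule countable_finite)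
  show "continuous_on (- {t. \<not> isCont F (complex_of_real t)}) (\<lambda>t. F (complex_of_real t))"
    by (rule continuous_at_imp_continuous_on)
       (auto intro!: isCont_o2[of _ complex_of_real F] continuous_intros)
qed

text \<open>For \<open>y \<ge> 0\<close> the right-hand side is at least
  \<open>1 + x\<^sup>2\<close>. The weight in \<open>hardy_lower\<close> therefore yields one
  integrable majorant for all horizontal lines in the closed lower half-plane.\<close>

lemma norm_shifted_square:
  "(norm (complex_of_real x - \<i> * complex_of_real y - \<i>))\<^sup>2 = x\<^sup>2 + (1 + y)\<^sup>2"
  by (simp add: cmod_power2) (simp add: power2_eq_square algebra_simps)

lemma integrable_inverse_square_bound:
  fixes f :: "real \<Rightarrow> 'a::{banach, second_countable_topology}"
  assumes "f \<in> borel_measurable borel" and "\<And>t. norm (f t) \<le> C / (1 + t\<^sup>2)"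
  shows "integrable lborel f"
  using integrable_mult_right[OF integrable_inverse_one_plus_square, of C]
  by (rule Bochner_Integration.integrable_bound)
     (use assms in \<open>auto intro!: AE_I2 order_trans[OF assms(2)] divide_right_mono\<close>)

lemma hardy_lower_measurable:
  "hardy_lower F \<Longrightarrow> (\<lambda>t. F (complex_of_real t)) \<in> borel_measurable borel"
  by (auto simp: hardy_lower_def intro: finite_discontinuities_measurable)

lemma hardy_lower_integrable:
  assumes "hardy_lower F"
  shows "integrable lborel (\<lambda>t. F (complex_of_real t))"
proof -
  obtain C where C: "\<And>z. Im z \<le> 0 \<Longrightarrow> norm (F z) \<le> C / (norm (z - \<i>))\<^sup>2"
    using assms by (auto simp: hardy_lower_def)
  have "norm (F (complex_of_real t)) \<le> C / (1 + t\<^sup>2)" for t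
    using C[of "of_real t"] norm_shifted_square[of t 0] by (simp add: add.commute)
  with hardy_lower_measurable[OF assms] show ?thesis
    by (rule integrable_inverse_square_bound)
qed

text \<open>A primitive of \<open>F\<close> has nearby values at both ends of a long horizontal segment, since the
  detour through the far sides of a square costs only \<open>4 * X * C / X\<^sup>2\<close>.\<close>

lemma lower_line_integral_zero:
  assumes hol: "F holomorphic_on {z. Im z < 0}"
    and C: "\<And>z. Im z < 0 \<Longrightarrow> norm (F z) \<le> C / (norm (z - \<i>))\<^sup>2" and e: "\<epsilon> > 0"
  shows "(LINT t|lborel. F (complex_of_real t - \<i> * complex_of_real \<epsilon>)) = 0"
proof -
  let ?f = "\<lambda>t. F (complex_of_real t - \<i> * complex_of_real \<epsilon>)"
  have op: "open {z. Im z < 0}" by (rule open_halfspace_Im_lt)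
  obtain P where P: "\<And>z. Im z < 0 \<Longrightarrow> (P has_field_derivative F z) (at z)"
    using holomorphic_convex_primitive'[OF convex_halfspace_Im_lt op hol] op
    by (metis at_within_open mem_Collect_eq)
  have C0: "C \<ge> 0"
    using order_trans[OF norm_ge_zero C[of "-\<i>"]] by (simp add: zero_le_divide_iff)
  have cont: "continuous_on UNIV ?f"
    by (rule continuous_on_compose2[OF holomorphic_on_imp_continuous_on[OF hol]])
       (use e in \<open>auto intro!: continuous_intros\<close>)
  then have meas: "?f \<in> borel_measurable borel"
    by (rule borel_measurable_continuous_onI)
  have "norm (?f t) \<le> C / (1 + t\<^sup>2)" for t
  proof -
    have "norm (?f t) \<le> C / (t\<^sup>2 + (1 + \<epsilon>)\<^sup>2)"
      using C[of "complex_of_real t - \<i> * complex_of_real \<epsilon>"] e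
      unfolding norm_shifted_square by simp
    also have "1 \<le> (1 + \<epsilon>)\<^sup>2" using e by (intro one_le_power) simp
    with zero_le_power2[of t] have "C / (t\<^sup>2 + (1 + \<epsilon>)\<^sup>2) \<le> C / (1 + t\<^sup>2)"
      using C0 e by (intro divide_left_mono mult_pos_pos) linarith+
    finally show ?thesis .
  qed
  with meas have int: "integrable lborel ?f"
    by (rule integrable_inverse_square_bound)
  \<comment> \<open>The segment of half-width \<open>X n\<close> at depth \<epsilon> is replaced by
    a detour down to depth \<open>X n\<close>. The offset 1 + \<epsilon> keeps \<open>X n\<close>
    positive and the bottom side below the segment.\<close>
  define X where "X n = 1 + \<epsilon> + real n" for n
  have X: "X n \<ge> \<epsilon>" "X n > 0" for n using e by (auto simp: X_def)
  have lim: "(\<lambda>n. LINT t|lborel. indicator {- X n..X n} t *\<^sub>R ?f t) \<longlonglongrightarrow> (LINT t|lborel. ?f t)"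
  proof (rule integral_dominated_convergence)
    show "integrable lborel (\<lambda>t. norm (?f t))" using int by simp
    show "AE t in lborel. (\<lambda>n. indicator {- X n..X n} t *\<^sub>R ?f t) \<longlonglongrightarrow> ?f t"
    proof (rule AE_I2)
      fix t :: real
      obtain N where N: "\<bar>t\<bar> \<le> real N" by (meson real_arch_simple)
      have "\<forall>\<^sub>F n in sequentially. indicator {- X n..X n} t *\<^sub>R ?f t = ?f t"
        using eventually_ge_at_top[of N]
        by eventually_elim (use N e in \<open>auto simp: X_def indicator_def\<close>)
      then show "(\<lambda>n. indicator {- X n..X n} t *\<^sub>R ?f t) \<longlonglongrightarrow> ?f t"
        by (rule tendsto_eventually)
    qed
  qed (use meas in \<open>auto split: split_indicator\<close>)
  have bound: "norm (LINT t|lborel. indicator {- X n..X n} t *\<^sub>R ?f t) \<le> 4 * C / X n" for n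
  proof -
    let ?a = "complex_of_real (X n) - \<i> * complex_of_real \<epsilon>"
      and ?b = "complex_of_real (X n) - \<i> * complex_of_real (X n)"
      and ?c = "- complex_of_real (X n) - \<i> * complex_of_real (X n)"
      and ?d = "- complex_of_real (X n) - \<i> * complex_of_real \<epsilon>"
    have "(LINT t|lborel. indicator {- X n..X n} t *\<^sub>R ?f t) = P ?a - P ?d"
    proof (subst integral_FTC_Icc)
      show "- X n \<le> X n" using X[of n] by simp
      show "((\<lambda>t. P (complex_of_real t - \<i> * complex_of_real \<epsilon>)) has_vector_derivative ?f t)
        (at t within {- X n..X n})" for t
      proof -
        have "((\<lambda>t. complex_of_real t - \<i> * complex_of_real \<epsilon>) has_vector_derivative 1) (at t)"
          by (auto intro!: derivative_eq_intros)
        from field_vector_diff_chain_at[OF this P] e show ?thesis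
          by (auto simp: o_def intro: has_vector_derivative_at_within)
      qed
      show "continuous_on {- X n..X n} ?f" using cont by (rule continuous_on_subset) simp
    qed simp
    \<comment> \<open>On every side of the detour the distance to \<open>\<i>\<close> is at least
      \<open>X n\<close>, so the derivative of \<open>P\<close> is at most
      \<open>C / (X n)\<^sup>2\<close> there. The sides are enclosed in half-planes or intersections
      of two, for which convexity is immediate.\<close>
    moreover have seg: "norm (P z - P w) \<le> C / (X n)\<^sup>2 * norm (z - w)"
      if "convex S" "z \<in> S" "w \<in> S" and S: "\<And>u. u \<in> S \<Longrightarrow> Im u < 0 \<and> X n \<le> norm (u - \<i>)" for z w S
    proof (rule field_differentiable_bound[where S=S and f'=F])
      fix u assume "u \<in> S"
      then have u: "Im u < 0" "X n \<le> norm (u - \<i>)" using S by auto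
      show "(P has_field_derivative F u) (at u within S)"
        using P[OF u(1)] by (rule has_field_derivative_at_within)
      have "norm (F u) \<le> C / (norm (u - \<i>))\<^sup>2" using C u by blast
      also have "\<dots> \<le> C / (X n)\<^sup>2"
        using u X[of n] C0 by (intro divide_left_mono power_mono mult_pos_pos zero_less_power) auto
      finally show "norm (F u) \<le> C / (X n)\<^sup>2" .
    qed (use that in auto)
    have Re_le: "\<bar>Re u\<bar> \<le> norm (u - \<i>)" and Im_le: "\<bar>Im u - 1\<bar> \<le> norm (u - \<i>)" for u
      using abs_Re_le_cmod[of "u - \<i>"] abs_Im_le_cmod[of "u - \<i>"] by auto
    have "norm (P ?a - P ?b) \<le> C / (X n)\<^sup>2 * norm (?a - ?b)"
    proof (rule seg[where S="{u. Im u < 0} \<inter> {u. Re u \<ge> X n}"])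
      show "Im u < 0 \<and> X n \<le> norm (u - \<i>)" if "u \<in> {u. Im u < 0} \<inter> {u. Re u \<ge> X n}" for u
        using Re_le[of u] that by auto
    qed (use e X[of n] in \<open>auto intro!: convex_Int convex_halfspace_Im_lt convex_halfspace_Re_ge\<close>)
    moreover have "norm (P ?b - P ?c) \<le> C / (X n)\<^sup>2 * norm (?b - ?c)"
    proof (rule seg[where S="{u. Im u \<le> - X n}"])
      show "Im u < 0 \<and> X n \<le> norm (u - \<i>)" if "u \<in> {u. Im u \<le> - X n}" for u
        using Im_le[of u] that X[of n] by auto
    qed (use e X[of n] in \<open>auto intro!: convex_halfspace_Im_le\<close>)
    moreover have "norm (P ?c - P ?d) \<le> C / (X n)\<^sup>2 * norm (?c - ?d)"
    proof (rule seg[where S="{u. Im u < 0} \<inter> {u. Re u \<le> - X n}"])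
      show "Im u < 0 \<and> X n \<le> norm (u - \<i>)" if "u \<in> {u. Im u < 0} \<inter> {u. Re u \<le> - X n}" for u
        using Re_le[of u] that by auto
    qed (use e X[of n] in \<open>auto intro!: convex_Int convex_halfspace_Im_lt convex_halfspace_Re_le\<close>)
    moreover have "norm (?a - ?b) \<le> X n" "norm (?b - ?c) \<le> 2 * X n" "norm (?c - ?d) \<le> X n"
      using X[of n] e by (auto simp: cmod_def real_sqrt_mult)
    moreover have "norm (P ?a - P ?d) \<le> norm (P ?a - P ?b) + norm (P ?b - P ?c) + norm (P ?c - P ?d)"
      by norm
    moreover have "C / (X n)\<^sup>2 \<ge> 0" using C0 by simp
    ultimately have "norm (LINT t|lborel. indicator {- X n..X n} t *\<^sub>R ?f t)
        \<le> C / (X n)\<^sup>2 * X n + C / (X n)\<^sup>2 * (2 * X n) + C / (X n)\<^sup>2 * X n"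
      by (smt (verit) mult_left_mono)
    also have "\<dots> = 4 * C / X n" using X[of n] by (simp add: power2_eq_square field_simps)
    finally show ?thesis .
  qed
  have "(\<lambda>n. 4 * C / X n) \<longlonglongrightarrow> 0"
    unfolding X_def by real_asymp
  then have "(\<lambda>n. LINT t|lborel. indicator {- X n..X n} t *\<^sub>R ?f t) \<longlonglongrightarrow> 0"
    using bound by (rule Lim_null_comparison[OF always_eventually[OF allI], rotated])
  with lim show ?thesis using LIMSEQ_unique by blast
qed

text \<open>The integral vanishes on the line at depth \<open>1 / Suc n\<close>, and these lines
  rise to the real axis. Dominated convergence passes to the limit; pointwise convergence can fail
  only at the finitely many discontinuities, a null set.\<close>

lemma hardy_lower_integral_zero:
  assumes "hardy_lower F"
  shows "(LINT t|lborel. F (complex_of_real t)) = 0"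
proof -
  obtain C where hol: "F holomorphic_on {z. Im z < 0}"
    and C: "\<And>z. Im z \<le> 0 \<Longrightarrow> norm (F z) \<le> C / (norm (z - \<i>))\<^sup>2"
    and fin: "finite {t. \<not> isCont F (complex_of_real t)}"
    using assms by (auto simp: hardy_lower_def)
  have C0: "C \<ge> 0"
    using order_trans[OF norm_ge_zero C[of 0]] by simp
  let ?e = "\<lambda>n. 1 / real (Suc n)"
  let ?f = "\<lambda>n t. F (complex_of_real t - \<i> * complex_of_real (?e n))"
  have "(\<lambda>n. LINT t|lborel. ?f n t) \<longlonglongrightarrow> (LINT t|lborel. F (complex_of_real t))"
  proof (rule integral_dominated_convergence)
    show "integrable lborel (\<lambda>t. C * (1 / (1 + t\<^sup>2)))"
      by (intro integrable_mult_right integrable_inverse_one_plus_square)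
    have "?f n \<in> borel_measurable borel" for n
      by (intro borel_measurable_continuous_onI
          continuous_on_compose2[OF holomorphic_on_imp_continuous_on[OF hol]])
         (auto intro!: continuous_intros)
    then show "?f n \<in> borel_measurable lborel" for n by simp
    show "(\<lambda>t. F (complex_of_real t)) \<in> borel_measurable lborel"
      using hardy_lower_measurable[OF assms] by simp
    show "AE t in lborel. norm (?f n t) \<le> C * (1 / (1 + t\<^sup>2))" for n
    proof (rule AE_I2)
      fix t
      have "norm (?f n t) \<le> C / (t\<^sup>2 + (1 + ?e n)\<^sup>2)"
        using C[of "complex_of_real t - \<i> * complex_of_real (?e n)"]
        unfolding norm_shifted_square by simp
      also have "1 \<le> (1 + ?e n)\<^sup>2" by (rule one_le_power) simp
      with zero_le_power2[of t] have "C / (t\<^sup>2 + (1 + ?e n)\<^sup>2) \<le> C / (1 + t\<^sup>2)"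
        using C0 by (intro divide_left_mono mult_pos_pos) linarith+
      finally show "norm (?f n t) \<le> C * (1 / (1 + t\<^sup>2))" by simp
    qed
    have "AE t in lborel. t \<notin> {t. \<not> isCont F (complex_of_real t)}"
      by (rule AE_not_in) (intro finite_imp_null_set_lborel fin)
    then show "AE t in lborel. (\<lambda>n. ?f n t) \<longlonglongrightarrow> F (complex_of_real t)"
    proof (rule AE_mp, intro AE_I2 impI)
      fix t assume "t \<notin> {t. \<not> isCont F (complex_of_real t)}"
      then have "isCont F (complex_of_real t)" by simp
      moreover have "?e \<longlonglongrightarrow> 0" by real_asymp
      then have "(\<lambda>n. complex_of_real t - \<i> * complex_of_real (?e n)) \<longlonglongrightarrow>
          complex_of_real t - \<i> * complex_of_real 0"
        by (intro tendsto_intros)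
      ultimately show "(\<lambda>n. ?f n t) \<longlonglongrightarrow> F (complex_of_real t)"
        by (intro isCont_tendsto_compose[of _ F]) auto
    qed
  qed
  moreover have "(LINT t|lborel. ?f n t) = 0" for n
    using lower_line_integral_zero[OF hol, of C "?e n"] C by auto
  ultimately show ?thesis by (simp add: LIMSEQ_const_iff)
qed

lemma hardy_lower_mult:
  assumes F: "hardy_lower F" and g: "g holomorphic_on {z. Im z < 0}"
    and B: "\<And>z. Im z \<le> 0 \<Longrightarrow> norm (g z) \<le> B"
    and fin: "finite {t. \<not> isCont g (complex_of_real t)}"
  shows "hardy_lower (\<lambda>z. F z * g z)"
  unfolding hardy_lower_def
proof (intro conjI)
  obtain C where C: "\<And>z. Im z \<le> 0 \<Longrightarrow> norm (F z) \<le> C / (norm (z - \<i>))\<^sup>2"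
    using F by (auto simp: hardy_lower_def)
  have "norm (F z * g z) \<le> C * B / (norm (z - \<i>))\<^sup>2" if "Im z \<le> 0" for z
    using mult_mono[OF C[OF that] B[OF that]] order_trans[OF norm_ge_zero C[OF that]]
    by (simp add: norm_mult)
  then show "\<exists>C. \<forall>z. Im z \<le> 0 \<longrightarrow> norm (F z * g z) \<le> C / (norm (z - \<i>))\<^sup>2"
    by blast
  show "finite {t. \<not> isCont (\<lambda>z. F z * g z) (complex_of_real t)}"
    by (rule finite_subset[of _ "{t. \<not> isCont F (complex_of_real t)} \<union> {t. \<not> isCont g (complex_of_real t)}"])
       (use F fin in \<open>auto simp: hardy_lower_def\<close>)
qed (use F g in \<open>auto simp: hardy_lower_def intro: holomorphic_intros\<close>)

lemma hardy_lower_inverse_square: "hardy_lower (\<lambda>z. 1 / (z - \<i>)\<^sup>2)"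
  unfolding hardy_lower_def
proof (intro conjI)
  show "(\<lambda>z. 1 / (z - \<i>)\<^sup>2) holomorphic_on {z. Im z < 0}"
    by (auto intro!: holomorphic_intros)
  show "\<exists>C. \<forall>z. Im z \<le> 0 \<longrightarrow> norm (1 / (z - \<i>)\<^sup>2) \<le> C / (norm (z - \<i>))\<^sup>2"
    by (intro exI[of _ 1]) (simp add: norm_divide norm_power)
  have "isCont (\<lambda>z. 1 / (z - \<i>)\<^sup>2) (complex_of_real t)" for t
  proof -
    have "complex_of_real t - \<i> \<noteq> 0" by (simp add: complex_eq_iff)
    then show ?thesis by (intro continuous_intros) simp
  qed
  then show "finite {t. \<not> isCont (\<lambda>z. 1 / (z - \<i>)\<^sup>2) (complex_of_real t)}" by simp
qed

section \<open>Oscillation tests\<close>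

text \<open>The number is the square of \<open>2 * sin (x / 2)\<close>. The two upper bounds control
  the squared kernel for large and for small arguments.\<close>

lemma two_minus_two_cos:
  shows "0 \<le> 2 - 2 * cos x" and "2 - 2 * cos x \<le> 4" and "2 - 2 * cos (x::real) \<le> x\<^sup>2"
proof -
  have "2 - 2 * cos x = (2 * sin (x / 2))\<^sup>2"
    using cos_double_sin[of "x / 2"] by (simp add: power2_eq_square)
  also have "\<dots> \<le> x\<^sup>2"
    using abs_sin_x_le_abs_x[of "x / 2"] by (subst abs_le_square_iff[symmetric]) simp
  finally show "2 - 2 * cos x \<le> x\<^sup>2" .
  show "0 \<le> 2 - 2 * cos x" "2 - 2 * cos x \<le> 4"
    using cos_le_one[of x] cos_ge_minus_one[of x] by linarith+
qed

text \<open>Dominated convergence turns the vanishing averages into \<open>h\<close> times the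
  integral of \<open>W\<close>. That integral is nonzero because \<open>W\<close> is nonnegative and
  is positive on an interval of positive length. The point 0, where no limit is assumed, is a null
  set.\<close>

lemma weighted_average_limit:
  fixes H :: "real \<Rightarrow> complex" and W :: "real \<Rightarrow> real"
  assumes H[measurable]: "H \<in> borel_measurable borel" and HC: "\<And>u. norm (H u) \<le> C"
    and W[measurable]: "W \<in> borel_measurable borel" and W0: "\<And>u. 0 \<le> W u"
    and WD: "\<And>u. W u \<le> D / (1 + u\<^sup>2)"
    and ab: "a < b" "\<And>u. a \<le> u \<Longrightarrow> u \<le> b \<Longrightarrow> W u > 0"
    and lim: "\<And>u. u \<noteq> 0 \<Longrightarrow> (\<lambda>n. H (r n * u)) \<longlonglongrightarrow> h"
    and zero: "\<And>n. (LINT u|lborel. H (r n * u) * complex_of_real (W u)) = 0"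
  shows "h = 0"
proof -
  have intW: "integrable lborel W"
    by (rule integrable_inverse_square_bound) (use W0 WD in auto)
  have "(\<lambda>n. LINT u|lborel. H (r n * u) * complex_of_real (W u)) \<longlonglongrightarrow>
      (LINT u|lborel. h * complex_of_real (W u))"
  proof (rule integral_dominated_convergence)
    show "integrable lborel (\<lambda>u. C * W u)" using intW by simp
    show "AE u in lborel. norm (H (r n * u) * complex_of_real (W u)) \<le> C * W u" for n
      using W0 HC by (auto simp: norm_mult intro!: mult_right_mono)
    have "AE u in lborel. u \<noteq> (0::real)" by (rule AE_lborel_singleton)
    then show "AE u in lborel. (\<lambda>n. H (r n * u) * complex_of_real (W u)) \<longlonglongrightarrow>
        h * complex_of_real (W u)"
      by (rule AE_mp) (intro AE_I2 impI tendsto_intros lim)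
  qed measurable
  then have "(LINT u|lborel. h * complex_of_real (W u)) = 0"
    unfolding zero by (simp add: LIMSEQ_const_iff)
  then have "h * complex_of_real (LINT u|lborel. W u) = 0"
    using intW by (simp add: integral_mult_right integral_complex_of_real)
  moreover have "(LINT u|lborel. W u) \<noteq> 0"
  proof
    assume "(LINT u|lborel. W u) = 0"
    then have "AE u in lborel. W u = 0"
      using integral_nonneg_eq_0_iff_AE[OF intW] W0 by auto
    then have "AE u in lborel. u \<notin> {a..b}"
      by (rule AE_mp) (use ab(2) in \<open>force intro!: AE_I2\<close>)
    then have "emeasure lborel {a..b} = 0"
      by (subst (asm) AE_iff_measurable[of "{a..b}"]) auto
    then show False using ab(1) by (simp add: emeasure_lborel_Icc_eq)
  qed
  ultimately show ?thesis by simp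
qed

text \<open>Substituting \<open>t = u / \<delta>\<close> and letting \<open>\<delta>\<close> tend to 0, the integral against the nonnegative kernel
  isolates the coefficient of \<open>1 / t ^ 4\<close> at infinity. The exponent 4 is dictated by the case of
  \<open>hardy_pairing_positive\<close> in which the leading term at infinity cancels.\<close>

lemma oscillation_test_at_infinity:
  fixes G :: "real \<Rightarrow> complex"
  assumes G[measurable]: "G \<in> borel_measurable borel"
    and C: "\<And>t. norm (of_real t ^ 4 * G t) \<le> C"
    and lim: "((\<lambda>t. of_real t ^ 4 * G t) \<longlongrightarrow> g) at_infinity"
    and \<eta>: "\<eta> > 0"
    and zero: "\<And>\<delta>. 0 < \<delta> \<Longrightarrow> \<delta> \<le> \<eta> \<Longrightarrow>
      (LINT t|lborel. G t * of_real ((2 - 2 * cos (\<delta> * t))\<^sup>2)) = 0"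
  shows "g = 0"
proof -
  let ?d = "\<lambda>n. \<eta> / real (Suc n)"
  let ?W = "\<lambda>u::real. (2 - 2 * cos u)\<^sup>2 / u ^ 4"
  show ?thesis
  \<comment> \<open>For small \<open>u\<close> the weight is at most 1 (at 0 it is 0 by division by
    zero). For large \<open>u\<close> it is at most \<open>16 / u ^ 4\<close>, and
    \<open>1 + u\<^sup>2 \<le> 2 * u ^ 4\<close> gives the constant 32. The interval from 1 to 2
    lies inside (0, pi), where the cosine is below 1.\<close>
  proof (rule weighted_average_limit[where r="\<lambda>n. 1 / ?d n" and W="?W" and D=32 and a=1 and b=2])
    show "(\<lambda>t. of_real t ^ 4 * G t) \<in> borel_measurable borel" by measurable
    show "norm (of_real t ^ 4 * G t) \<le> C" for t by (rule C)
    show "?W \<in> borel_measurable borel" by measurable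
    show "?W u \<le> 32 / (1 + u\<^sup>2)" for u
    proof (cases "\<bar>u\<bar> \<le> 1")
      case True
      have "(2 - 2 * cos u)\<^sup>2 \<le> (u\<^sup>2)\<^sup>2"
        using two_minus_two_cos[of u] by (intro power_mono) auto
      then have "?W u \<le> 1"
        by (cases "u = 0") (auto simp: divide_le_eq simp flip: power_mult)
      also have "u\<^sup>2 \<le> 1" using True by (simp add: abs_square_le_1)
      then have "1 \<le> 32 / (1 + u\<^sup>2)" by (simp add: le_divide_eq add_pos_nonneg)
      finally show ?thesis .
    next
      case False
      then have u: "u\<^sup>2 > 1" by (metis abs_square_le_1 not_less)
      have "?W u \<le> 4\<^sup>2 / (u\<^sup>2 * u\<^sup>2)"
        using two_minus_two_cos[of u]
        by (intro frac_le power_mono) (use u in \<open>auto simp flip: power_add intro!: zero_less_power\<close>)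
      also have "\<dots> \<le> 32 / (1 + u\<^sup>2)"
      proof -
        have "1 + u\<^sup>2 \<le> 2 * (u\<^sup>2 * u\<^sup>2)"
          using u mult_mono[of 1 "u\<^sup>2" "u\<^sup>2" "u\<^sup>2"] by linarith
        then have "32 / (2 * (u\<^sup>2 * u\<^sup>2)) \<le> 32 / (1 + u\<^sup>2)"
          using u by (intro divide_left_mono mult_pos_pos) linarith+
        then show ?thesis by simp
      qed
      finally show ?thesis .
    qed
    show "?W u > 0" if "1 \<le> u" "u \<le> 2" for u
      using that cos_monotone_0_pi[of 0 u] pi_gt3 by (auto intro!: divide_pos_pos)
    show "(\<lambda>n. of_real (1 / ?d n * u) ^ 4 * G (1 / ?d n * u)) \<longlonglongrightarrow> g" if "u \<noteq> 0" for u
    proof (rule filterlim_compose[OF lim])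
      have "filterlim (\<lambda>n. real (Suc n) / \<eta> * \<bar>u\<bar>) at_top sequentially"
        using \<eta> that by real_asymp
      then show "filterlim (\<lambda>n. 1 / ?d n * u) at_infinity sequentially"
        using \<eta> by (simp add: filterlim_at_infinity_conv_norm_at_top abs_mult)
    qed
    show "(LINT u|lborel. of_real (1 / ?d n * u) ^ 4 * G (1 / ?d n * u) * of_real (?W u)) = 0" for n
    proof -
      define \<delta> where "\<delta> = ?d n"
      have \<delta>: "0 < \<delta>" "\<delta> \<le> \<eta>" using \<eta> by (auto simp: \<delta>_def divide_le_eq)
      have "(LINT t|lborel. G t * of_real ((2 - 2 * cos (\<delta> * t))\<^sup>2)) = \<bar>1 / \<delta>\<bar> *\<^sub>R
          (LINT u|lborel. G (0 + 1 / \<delta> * u) * of_real ((2 - 2 * cos (\<delta> * (0 + 1 / \<delta> * u)))\<^sup>2))"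
        using \<delta> by (intro lborel_integral_real_affine) simp
      with zero[OF \<delta>] \<delta> have "(LINT u|lborel. G (1 / \<delta> * u) * of_real ((2 - 2 * cos u)\<^sup>2)) = 0"
        by simp
      moreover have "of_real (1 / \<delta> * u) ^ 4 * G (1 / \<delta> * u) * of_real (?W u)
          = complex_of_real (1 / \<delta> ^ 4) * (G (1 / \<delta> * u) * of_real ((2 - 2 * cos u)\<^sup>2))" for u
        using \<delta> by (cases "u = 0") (simp_all add: field_simps)
      ultimately show ?thesis unfolding \<delta>_def[symmetric] by simp
    qed
  qed auto
qed

text \<open>Counterpart of the previous test under inversion of the variable:
  \<open>t = \<delta> * u\<close> with \<delta> tending to 0 isolates the coefficient of
  \<open>t\<^sup>2\<close> at the origin. The weight is at most 16 near 0 and at most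
  \<open>1 / u\<^sup>2\<close> for large \<open>u\<close>, where the quadratic bound on the kernel
  is used.\<close>

lemma oscillation_test_at_zero:
  fixes K :: "real \<Rightarrow> complex"
  assumes K[measurable]: "K \<in> borel_measurable borel"
    and C: "\<And>t. norm (K t) \<le> C * t\<^sup>2"
    and lim: "((\<lambda>t. K t / of_real t ^ 2) \<longlongrightarrow> k) (at 0)"
    and \<eta>: "\<eta> > 0"
    and zero: "\<And>\<delta>. 0 < \<delta> \<Longrightarrow> \<delta> \<le> \<eta> \<Longrightarrow>
      (LINT t|lborel. K t * of_real ((2 - 2 * cos (\<delta> / t))\<^sup>2)) = 0"
  shows "k = 0"
proof -
  let ?d = "\<lambda>n. \<eta> / real (Suc n)"
  let ?W = "\<lambda>u::real. u\<^sup>2 * (2 - 2 * cos (1 / u))\<^sup>2"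
  have C0: "C \<ge> 0" using order_trans[OF norm_ge_zero C[of 1]] by simp
  show ?thesis
  proof (rule weighted_average_limit[where r="?d" and W="?W" and D=32 and a="1/2" and b=1])
    show "(\<lambda>t. K t / of_real t ^ 2) \<in> borel_measurable borel" by measurable
    show "norm (K t / of_real t ^ 2) \<le> C" for t
      using C[of t] C0 by (cases "t = 0") (auto simp: norm_divide norm_power divide_le_eq)
    show "?W \<in> borel_measurable borel" by measurable
    show "?W u \<le> 32 / (1 + u\<^sup>2)" for u
    proof (cases "\<bar>u\<bar> \<le> 1")
      case True
      then have u: "u\<^sup>2 \<le> 1" by (simp add: abs_square_le_1)
      have "?W u \<le> 1 * 4\<^sup>2"
        using two_minus_two_cos[of "1 / u"] u by (intro mult_mono power_mono) auto
      also have "\<dots> \<le> 32 / (1 + u\<^sup>2)"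
        using u by (simp add: le_divide_eq add_pos_nonneg)
      finally show ?thesis by simp
    next
      case False
      then have u: "u\<^sup>2 > 1" by (metis abs_square_le_1 not_less)
      have "?W u \<le> u\<^sup>2 * ((1 / u)\<^sup>2)\<^sup>2"
        using two_minus_two_cos[of "1 / u"] by (intro mult_left_mono power_mono) auto
      also have "\<dots> = 1 / u\<^sup>2" using u by (simp add: field_simps power2_eq_square)
      also have "\<dots> \<le> 32 / (1 + u\<^sup>2)"
      proof -
        have "1 + u\<^sup>2 \<le> 32 * u\<^sup>2" using u by linarith
        then show ?thesis using u by (simp add: divide_le_eq le_divide_eq add_pos_nonneg)
      qed
      finally show ?thesis .
    qed
    show "?W u > 0" if "1/2 \<le> u" "u \<le> 1" for u
    proof -
      have "0 < 1 / u" "1 / u \<le> 2" using that by (auto simp: field_simps)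
      then show ?thesis
        using that cos_monotone_0_pi[of 0 "1 / u"] pi_gt3 by (auto intro!: mult_pos_pos)
    qed
    show "(\<lambda>n. K (?d n * u) / of_real (?d n * u) ^ 2) \<longlonglongrightarrow> k" if "u \<noteq> 0" for u
    proof (rule filterlim_compose[OF lim])
      have "(\<lambda>n. ?d n * u) \<longlonglongrightarrow> 0" by real_asymp
      then show "filterlim (\<lambda>n. ?d n * u) (at 0) sequentially"
        using \<eta> that by (auto simp: filterlim_at)
    qed
    show "(LINT u|lborel. K (?d n * u) / of_real (?d n * u) ^ 2 * of_real (?W u)) = 0" for n
    proof -
      define \<delta> where "\<delta> = ?d n"
      have \<delta>: "0 < \<delta>" "\<delta> \<le> \<eta>" using \<eta> by (auto simp: \<delta>_def divide_le_eq)
      have "(LINT t|lborel. K t * of_real ((2 - 2 * cos (\<delta> / t))\<^sup>2)) = \<bar>\<delta>\<bar> *\<^sub>R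
          (LINT u|lborel. K (0 + \<delta> * u) * of_real ((2 - 2 * cos (\<delta> / (0 + \<delta> * u)))\<^sup>2))"
        using \<delta> by (intro lborel_integral_real_affine) simp
      with zero[OF \<delta>] \<delta> have "(LINT u|lborel. K (\<delta> * u) * of_real ((2 - 2 * cos (1 / u))\<^sup>2)) = 0"
        by simp
      moreover have "K (\<delta> * u) / of_real (\<delta> * u) ^ 2 * of_real (?W u)
          = complex_of_real (1 / \<delta> ^ 2) * (K (\<delta> * u) * of_real ((2 - 2 * cos (1 / u))\<^sup>2))" for u
        using \<delta> by (cases "u = 0") (simp_all add: field_simps)
      ultimately show ?thesis unfolding \<delta>_def[symmetric] by simp
    qed
  qed auto
qed

section \<open>Waves and their boundedness in the lower half-plane\<close>

definition wave :: "real \<Rightarrow> real \<Rightarrow> complex \<Rightarrow> complex" where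
  "wave A B z = exp (\<i> * (of_real A * z + of_real B / z))"

lemma wave_0_0 [simp]: "wave 0 0 z = 1"
  by (simp add: wave_def)

lemma wave_mult: "wave A B z * wave A' B' z = wave (A + A') (B + B') z"
  by (simp add: wave_def add_divide_distrib algebra_simps flip: exp_add)

lemma wave_shift: "wave A 0 (z - of_real p) = exp (- \<i> * of_real (A * p)) * wave A 0 z"
  by (simp add: wave_def algebra_simps flip: exp_add)

text \<open>The modulus is the exponential of minus the imaginary part of
  \<open>A * z + B / z\<close>, and the signs make both contributions to that part nonnegative. At
  \<open>z = 0\<close> division by zero makes the wave equal to 1, so the bound needs no
  exception.\<close>

lemma norm_wave_le_1:
  assumes "A \<le> 0" "0 \<le> B" "Im z \<le> 0"
  shows "norm (wave A B z) \<le> 1"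
proof -
  have "0 \<le> A * Im z" using assms by (simp add: mult_nonpos_nonpos)
  moreover have "0 \<le> Im (of_real B / z)"
    using assms by (simp add: Im_divide mult_nonneg_nonpos divide_nonneg_nonneg divide_nonpos_nonneg)
  ultimately show ?thesis by (simp add: wave_def)
qed

lemma norm_wave_of_real [simp]: "norm (wave A B (of_real t)) = 1"
proof -
  have "wave A B (of_real t) = exp (\<i> * of_real (A * t + B / t))"
    by (simp add: wave_def)
  then show ?thesis by (simp only: norm_exp_i_times)
qed

lemma wave_measurable [measurable]: "(\<lambda>t. wave A B (of_real t)) \<in> borel_measurable borel"
  unfolding wave_def by measurable

lemma isCont_wave: "z \<noteq> of_real q \<Longrightarrow> isCont (\<lambda>z. wave A B (z - of_real q)) z"
  unfolding wave_def by (intro continuous_intros) simp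

lemma finite_discontinuities_wave:
  "finite {t. \<not> isCont (\<lambda>z. wave A B (z - of_real q)) (complex_of_real t)}"
  by (rule finite_subset[of _ "{q}"]) (auto intro: isCont_wave)

lemma holomorphic_wave: "(\<lambda>z. wave A B (z - of_real q)) holomorphic_on {z. Im z < 0}"
  unfolding wave_def by (intro holomorphic_intros) auto

lemma hardy_lower_wave:
  assumes "hardy_lower F" "A \<le> 0" "0 \<le> B"
  shows "hardy_lower (\<lambda>z. F z * wave A B (z - of_real q))"
  using assms by (intro hardy_lower_mult[where B=1] holomorphic_wave finite_discontinuities_wave
      norm_wave_le_1) auto

lemma hardy_lower_wave_0:
  "hardy_lower F \<Longrightarrow> A \<le> 0 \<Longrightarrow> 0 \<le> B \<Longrightarrow> hardy_lower (\<lambda>z. F z * wave A B z)"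
  using hardy_lower_wave[of F A B 0] by simp

lemma integrable_mult_wave [intro]:
  "integrable lborel f \<Longrightarrow> integrable lborel (\<lambda>t. f t * wave A B (of_real t))"
  by (rule Bochner_Integration.integrable_bound[of lborel f]) (auto simp: norm_mult)

lemma square_two_minus_two_cos_wave:
  "of_real ((2 - 2 * cos (a * t + b / t))\<^sup>2) = 6 - 4 * wave a b (of_real t) - 4 * wave (-a) (-b) (of_real t)
     + wave (2 * a) (2 * b) (of_real t) + wave (-2 * a) (-2 * b) (of_real t)"
proof -
  let ?p = "wave a b (of_real t)" and ?m = "wave (-a) (-b) (of_real t)"
  have "complex_of_real (cos (a * t + b / t)) = (?p + ?m) / 2"
    by (simp add: cos_of_real[symmetric] cos_exp_eq wave_def algebra_simps)
  then have cos: "complex_of_real (2 * cos (a * t + b / t)) = ?p + ?m"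
    unfolding of_real_mult by (simp add: field_simps)
  have 1: "?p * ?m = 1" by (simp add: wave_mult)
  have 2: "wave (2 * a) (2 * b) (of_real t) = ?p * ?p" "wave (-2 * a) (-2 * b) (of_real t) = ?m * ?m"
    by (simp_all add: wave_mult)
  have "complex_of_real ((2 - 2 * cos (a * t + b / t))\<^sup>2) = (2 - (?p + ?m))\<^sup>2"
    by (simp only: of_real_power of_real_diff of_real_numeral cos)
  also have "\<dots> = 4 + 2 * (?p * ?m) - 4 * ?p - 4 * ?m + ?p * ?p + ?m * ?m"
    by (simp add: power2_eq_square algebra_simps)
  finally show ?thesis unfolding 1 2 by simp
qed

text \<open>The squared kernel is a combination of the constant 1 and the four waves whose
  frequencies are plus or minus one and two times (a, b), so orthogonality to these five functions
  suffices.\<close>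

lemma integral_two_minus_two_cos_zero:
  fixes G :: "real \<Rightarrow> complex"
  assumes "integrable lborel G"
    and "\<And>c. c \<in> {-2, -1, 0, 1, 2} \<Longrightarrow> (LINT t|lborel. G t * wave (c * a) (c * b) (of_real t)) = 0"
  shows "(LINT t|lborel. G t * of_real ((2 - 2 * cos (a * t + b / t))\<^sup>2)) = 0"
proof -
  have "(LINT t|lborel. G t * of_real ((2 - 2 * cos (a * t + b / t))\<^sup>2)) =
      (LINT t|lborel. 6 * G t - 4 * (G t * wave a b (of_real t)) - 4 * (G t * wave (-a) (-b) (of_real t))
        + G t * wave (2 * a) (2 * b) (of_real t) + G t * wave (-2 * a) (-2 * b) (of_real t))"
    unfolding square_two_minus_two_cos_wave by (simp add: algebra_simps)
  also have "\<dots> = 6 * (LINT t|lborel. G t) - 4 * (LINT t|lborel. G t * wave a b (of_real t))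
      - 4 * (LINT t|lborel. G t * wave (-a) (-b) (of_real t))
      + (LINT t|lborel. G t * wave (2 * a) (2 * b) (of_real t))
      + (LINT t|lborel. G t * wave (-2 * a) (-2 * b) (of_real t))"
    using assms(1) integrable_mult_wave[OF assms(1)] by simp
  also have "\<dots> = 0"
    using assms(2)[of 0] assms(2)[of 1] assms(2)[of "-1"] assms(2)[of 2] assms(2)[of "-2"] by simp
  finally show ?thesis .
qed

section \<open>Separating a frequency\<close>

definition wave_transform :: "(real \<Rightarrow> complex) \<Rightarrow> real \<Rightarrow> real \<Rightarrow> complex" where
  "wave_transform f A B = (LINT t|lborel. f t * wave A B (of_real t))"

text \<open>This multiplier installs a zero at a real point \<open>q\<close> without leaving the
  class, since \<open>z - \<i>\<close> stays away from 0 and dominates \<open>z - q\<close> in the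
  closed lower half-plane. Such zeros supply the decay at 0, or cancel the singular points, in the
  pairings below.\<close>

lemma hardy_lower_Cayley:
  assumes "hardy_lower F"
  shows "hardy_lower (\<lambda>z. F z * ((z - of_real q) / (z - \<i>)))"
proof (rule hardy_lower_mult[OF assms])
  show "(\<lambda>z. (z - of_real q) / (z - \<i>)) holomorphic_on {z. Im z < 0}"
    by (intro holomorphic_intros) auto
  show "norm ((z - of_real q) / (z - \<i>)) \<le> 2 + \<bar>q\<bar>" if "Im z \<le> 0" for z
  proof -
    have 1: "1 \<le> norm (z - \<i>)"
      using abs_Im_le_cmod[of "z - \<i>"] that by simp
    have "norm (z - of_real q) \<le> norm (z - \<i>) + norm (\<i> - of_real q)"
      using norm_triangle_ineq[of "z - \<i>" "\<i> - of_real q"] by simp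
    also have "norm (\<i> - of_real q) \<le> 1 + \<bar>q\<bar>"
      using norm_triangle_ineq4[of \<i> "of_real q"] by simp
    also have "1 + \<bar>q\<bar> \<le> (1 + \<bar>q\<bar>) * norm (z - \<i>)"
      using mult_left_mono[OF 1, of "1 + \<bar>q\<bar>"] by simp
    finally have "norm (z - of_real q) \<le> (2 + \<bar>q\<bar>) * norm (z - \<i>)"
      by (simp add: algebra_simps)
    then show ?thesis using 1 by (simp add: norm_divide divide_le_eq)
  qed
  have "isCont (\<lambda>z. (z - of_real q) / (z - \<i>)) (complex_of_real t)" for t
  proof -
    have "complex_of_real t - \<i> \<noteq> 0" by (simp add: complex_eq_iff)
    then show ?thesis by (intro continuous_intros) simp
  qed
  then show "finite {t. \<not> isCont (\<lambda>z. (z - of_real q) / (z - \<i>)) (complex_of_real t)}" by simp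
qed

lemma norm_of_real_minus_i: "\<bar>t\<bar> \<le> norm (complex_of_real t - \<i>)" "1 \<le> norm (complex_of_real t - \<i>)"
  using abs_Re_le_cmod[of "complex_of_real t - \<i>"] abs_Im_le_cmod[of "complex_of_real t - \<i>"]
  by auto

text \<open>If every pairing vanished, a suitable \<open>F\<close> would turn the translated wave
  into a Hardy integrand, whose integral is zero, and leave \<open>K\<close> paired with
  \<open>wave 0 (- \<delta>)\<close>. Nonnegative frequencies against \<open>K\<close> vanish by
  Cauchy's theorem, so the test at zero applies and contradicts the nonzero coefficient of
  \<open>t\<^sup>2\<close> in \<open>K\<close>.\<close>

lemma hardy_pairing_negative:
  assumes "B < 0" and p: "p > 0"
  shows "\<exists>F. hardy_lower F \<and>
    (LINT t|lborel. F (of_real t) * (wave A B (of_real t - of_real p) - wave A B (of_real t))) \<noteq> 0"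
proof (rule ccontr)
  assume contra: "\<not> ?thesis"
  \<comment> \<open>The double zero at the origin is what the test at zero requires.\<close>
  define F0 where "F0 z = 1 / (z - \<i>)\<^sup>2 * ((z - of_real 0) / (z - \<i>)) * ((z - of_real 0) / (z - \<i>))" for z
  have F0: "hardy_lower F0"
    unfolding F0_def by (intro hardy_lower_Cayley hardy_lower_inverse_square)
  \<comment> \<open>The frequency \<open>A - \<bar>A\<bar>\<close> is nonpositive for either sign of
    \<open>A\<close>, and \<open>- B\<close> is positive, so both waves are bounded multipliers. The
    singular point of the last one is at \<open>p\<close>, away from 0.\<close>
  define K where "K z = F0 z * wave (A - \<bar>A\<bar>) 0 z * wave 0 (- B) (z - of_real p)" for z
  have K: "hardy_lower K"
    unfolding K_def using assms by (intro hardy_lower_wave hardy_lower_wave_0 F0) auto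
  have neg: "(LINT t|lborel. K (of_real t) * wave 0 (- \<delta>) (of_real t)) = 0"
    if \<delta>: "0 < \<delta>" "\<delta> \<le> - B" for \<delta>
  proof -
    \<comment> \<open>The factors cancel \<open>wave A B (z - p)\<close> exactly and \<open>wave A B z\<close> up to \<open>wave 0 (- \<delta>) z\<close>.\<close>
    define F where "F z = F0 z * wave (- \<bar>A\<bar>) 0 z * wave 0 (- B) (z - of_real p) * wave 0 (- B - \<delta>) z" for z
    have F: "hardy_lower F"
      unfolding F_def using assms \<delta> by (intro hardy_lower_wave hardy_lower_wave_0 F0) auto
    let ?e = "exp (- \<i> * of_real (A * p))"
    let ?L = "\<lambda>z. F0 z * wave (A - \<bar>A\<bar>) 0 z * wave 0 (- B - \<delta>) z"
    have L: "hardy_lower ?L"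
      using assms \<delta> by (intro hardy_lower_wave_0 F0) auto
    have 1: "F z * wave A B (z - of_real p) = ?e * ?L z" for z
    proof -
      have "wave A B (z - of_real p) = wave A 0 (z - of_real p) * wave 0 B (z - of_real p)"
        by (simp add: wave_mult)
      also have "wave A 0 (z - of_real p) = ?e * wave A 0 z" by (rule wave_shift)
      finally have "F z * wave A B (z - of_real p) = F0 z * (wave A 0 z * wave (- \<bar>A\<bar>) 0 z) *
          (wave 0 B (z - of_real p) * wave 0 (- B) (z - of_real p)) * wave 0 (- B - \<delta>) z * ?e"
        by (simp add: F_def mult_ac)
      then show ?thesis by (simp add: wave_mult mult_ac)
    qed
    have 2: "F z * wave A B z = K z * wave 0 (- \<delta>) z" for z
    proof -
      have "F z * wave A B z = F0 z * (wave A B z * wave (- \<bar>A\<bar>) 0 z * wave 0 (- B - \<delta>) z) *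
          wave 0 (- B) (z - of_real p)"
        by (simp add: F_def mult_ac)
      also have "wave A B z * wave (- \<bar>A\<bar>) 0 z * wave 0 (- B - \<delta>) z
          = wave (A - \<bar>A\<bar>) 0 z * wave 0 (- \<delta>) z"
        by (simp add: wave_mult)
      finally show ?thesis by (simp add: K_def mult_ac)
    qed
    have "0 = (LINT t|lborel. F (of_real t) * (wave A B (of_real t - of_real p) - wave A B (of_real t)))"
      using contra F by auto
    also have "\<dots> = (LINT t|lborel. ?e * ?L (of_real t) - K (of_real t) * wave 0 (- \<delta>) (of_real t))"
      unfolding right_diff_distrib 1 2 ..
    also have "\<dots> = ?e * (LINT t|lborel. ?L (of_real t))
        - (LINT t|lborel. K (of_real t) * wave 0 (- \<delta>) (of_real t))"
      using hardy_lower_integrable[OF L] integrable_mult_wave[OF hardy_lower_integrable[OF K]]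
      by (subst Bochner_Integration.integral_diff) auto
    finally show ?thesis using hardy_lower_integral_zero[OF L] by simp
  qed
  let ?h = "\<lambda>t. inverse ((complex_of_real t - \<i>) ^ 4) * (wave (A - \<bar>A\<bar>) 0 (of_real t) *
      wave 0 (- B) (of_real t - of_real p))"
  have Kh: "K (of_real t) = of_real t ^ 2 * ?h t" for t
    by (simp add: K_def F0_def power2_eq_square power4_eq_xxxx divide_inverse mult_ac)
  have "?h 0 = 0"
  proof (rule oscillation_test_at_zero)
    show "(\<lambda>t. K (of_real t)) \<in> borel_measurable borel"
      by (rule hardy_lower_measurable[OF K])
    show "norm (K (of_real t)) \<le> 1 * t\<^sup>2" for t
    proof -
      have w: "norm (wave 0 (- B) (of_real t - of_real p)) = 1"
        using norm_wave_of_real[of 0 "- B" "t - p"] by simp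
      have "norm (?h t) \<le> 1"
        using norm_of_real_minus_i(2)[of t] one_le_power[of "norm (complex_of_real t - \<i>)" 4]
        by (simp add: norm_mult norm_inverse norm_power w inverse_le_1_iff)
      then show ?thesis
        unfolding Kh norm_mult norm_power by (simp add: mult_left_le)
    qed
    \<comment> \<open>The squared kernel contains the frequency \<open>2 * \<delta>\<close>, which
      must not exceed the limit \<open>- B\<close> in \<open>neg\<close>.\<close>
    show "0 < - B / 2" using assms by simp
    show "(LINT t|lborel. K (of_real t) * of_real ((2 - 2 * cos (\<delta> / t))\<^sup>2)) = 0"
      if "0 < \<delta>" "\<delta> \<le> - B / 2" for \<delta>
    proof -
      have "(LINT t|lborel. K (of_real t) * of_real ((2 - 2 * cos (0 * t + \<delta> / t))\<^sup>2)) = 0"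
      proof (rule integral_two_minus_two_cos_zero[OF hardy_lower_integrable[OF K]])
        fix c :: real assume c: "c \<in> {-2, -1, 0, 1, 2}"
        show "(LINT t|lborel. K (of_real t) * wave (c * 0) (c * \<delta>) (of_real t)) = 0"
        proof (cases "c < 0")
          case True
          then show ?thesis using c that neg[of "- c * \<delta>"] by auto
        next
          case False
          then show ?thesis
            using that hardy_lower_integral_zero[OF hardy_lower_wave_0[OF K, of 0 "c * \<delta>"]] by simp
        qed
      qed
      then show ?thesis by simp
    qed
    have "isCont ?h 0"
    proof -
      have "complex_of_real 0 - \<i> \<noteq> 0" "complex_of_real 0 - of_real p \<noteq> 0" using p by auto
      \<comment> \<open>Rewriting \<open>0 / z\<close> to 0 removes the apparent singularity at the
        origin of the untranslated wave.\<close>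
      then show ?thesis
        unfolding wave_def of_real_0 div_0 by (intro continuous_intros) auto
    qed
    then have "?h \<midarrow>0\<rightarrow> ?h 0" by (simp only: isCont_def)
    moreover have "\<forall>\<^sub>F t in at 0. ?h t = K (of_real t) / of_real t ^ 2"
      using eventually_neq_at_within[of 0] by eventually_elim (simp only: Kh, simp)
    ultimately show "((\<lambda>t. K (of_real t) / of_real t ^ 2) \<longlongrightarrow> ?h 0) (at 0)"
      by (rule Lim_transform_eventually)
  qed
  \<comment> \<open>The value \<open>?h 0\<close> is a product of exponentials and an inverse power
    of \<open>- \<i>\<close>, hence not zero.\<close>
  moreover have "(0::complex) - \<i> \<noteq> 0" by simp
  ultimately show False by (simp add: wave_def)
qed

text \<open>Factoring \<open>wave A 0 z\<close> out of the wave difference leaves the bounded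
  function \<open>D\<close>. If every pairing vanished, each product \<open>H * D\<close> with
  \<open>H\<close> in the class would be orthogonal to the frequencies in (0, A], and by Cauchy's
  theorem to the nonpositive ones too. The test at infinity then kills its coefficient of
  \<open>1 / t ^ 4\<close>.\<close>

lemma hardy_pairing_positive:
  assumes A: "A > 0" and B: "B \<ge> 0" and p: "p > 0"
    and nt: "exp (- \<i> * of_real (A * p)) \<noteq> 1 \<or> B > 0"
  shows "\<exists>F. hardy_lower F \<and>
    (LINT t|lborel. F (of_real t) * (wave A B (of_real t - of_real p) - wave A B (of_real t))) \<noteq> 0"
proof (rule ccontr)
  assume "\<not> ?thesis"
  then have contra: "(LINT t|lborel. F (of_real t) *
      (wave A B (of_real t - of_real p) - wave A B (of_real t))) = 0" if "hardy_lower F" for F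
    using that by auto
  define e where "e = exp (- \<i> * of_real (A * p))"
  define D where "D z = e * wave 0 B (z - of_real p) - wave 0 B z" for z
  have norm_D: "norm (D z) \<le> 2" if "Im z \<le> 0" for z
  proof -
    have "norm e = 1" using norm_exp_i_times[of "- (A * p)"] by (simp add: e_def)
    then have "norm (D z) \<le> norm (wave 0 B (z - of_real p)) + norm (wave 0 B z)"
      using norm_triangle_ineq4[of "e * wave 0 B (z - of_real p)" "wave 0 B z"]
      by (simp add: norm_mult D_def)
    also have "\<dots> \<le> 1 + 1" using that B by (intro add_mono norm_wave_le_1) auto
    finally show ?thesis by simp
  qed
  \<comment> \<open>It remains to find one \<open>H\<close> for which \<open>t ^ 4 * H * D\<close>
    is bounded and has a nonzero limit.\<close>
  have test: "g = 0"
    if H: "hardy_lower H"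
      and C: "\<And>t. norm (of_real t ^ 4 * (H (of_real t) * D (of_real t))) \<le> C"
      and lim: "((\<lambda>t. of_real t ^ 4 * (H (of_real t) * D (of_real t))) \<longlongrightarrow> g) at_infinity"
    for H C g
  proof -
    define G where "G z = H z * D z" for z
    have G: "hardy_lower G"
      unfolding G_def
    proof (rule hardy_lower_mult[OF H, where B=2])
      show "D holomorphic_on {z. Im z < 0}"
        unfolding D_def using holomorphic_wave[of 0 B p] holomorphic_wave[of 0 B 0]
        by (intro holomorphic_intros) auto
      show "norm (D z) \<le> 2" if "Im z \<le> 0" for z using that by (rule norm_D)
      have cont: "isCont D z" if "z \<noteq> of_real p" "z \<noteq> of_real 0" for z
        unfolding D_def using isCont_wave[OF that(1), of 0 B] isCont_wave[OF that(2), of 0 B]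
        by (intro continuous_intros) auto
      have "{t. \<not> isCont D (complex_of_real t)} \<subseteq> {p, 0}"
      proof
        fix t assume "t \<in> {t. \<not> isCont D (complex_of_real t)}"
        then show "t \<in> {p, 0}" using cont[of "of_real t"] by (metis insertI1 insertI2 mem_Collect_eq of_real_eq_iff)
      qed
      then show "finite {t. \<not> isCont D (complex_of_real t)}" by (rule finite_subset) simp
    qed
    have pos: "(LINT t|lborel. G (of_real t) * wave \<delta> 0 (of_real t)) = 0"
      if \<delta>: "0 < \<delta>" "\<delta> \<le> A" for \<delta>
    proof -
      \<comment> \<open>The frequency \<delta> - A is nonpositive, so \<open>?F\<close> stays in the
        class; multiplied by the factor \<open>wave A 0\<close> it leaves exactly the frequency
        \<delta>.\<close>
      let ?F = "\<lambda>z. H z * wave (\<delta> - A) 0 z"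
      have F: "hardy_lower ?F"
        using \<delta> by (intro hardy_lower_wave_0 H) auto
      have eq: "?F z * (wave A B (z - of_real p) - wave A B z) = G z * wave \<delta> 0 z" for z
      proof -
        have "wave A B (z - of_real p) = wave A 0 (z - of_real p) * wave 0 B (z - of_real p)"
          and 1: "wave A B z = wave A 0 z * wave 0 B z"
          by (simp_all add: wave_mult)
        moreover have "wave A 0 (z - of_real p) = e * wave A 0 z"
          unfolding e_def by (rule wave_shift)
        moreover have "wave \<delta> 0 z = wave (\<delta> - A) 0 z * wave A 0 z" by (simp add: wave_mult)
        ultimately show ?thesis by (simp add: G_def D_def algebra_simps)
      qed
      from contra[OF F] show ?thesis unfolding eq .
    qed
    have zero: "(LINT t|lborel. G (of_real t) * of_real ((2 - 2 * cos (\<delta> * t))\<^sup>2)) = 0"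
      if "0 < \<delta>" "\<delta> \<le> A / 2" for \<delta>
    proof -
      have "(LINT t|lborel. G (of_real t) * of_real ((2 - 2 * cos (\<delta> * t + 0 / t))\<^sup>2)) = 0"
      proof (rule integral_two_minus_two_cos_zero[OF hardy_lower_integrable[OF G]])
        fix c :: real assume c: "c \<in> {-2, -1, 0, 1, 2}"
        show "(LINT t|lborel. G (of_real t) * wave (c * \<delta>) (c * 0) (of_real t)) = 0"
        proof (cases "c > 0")
          case True
          then show ?thesis using c that pos[of "c * \<delta>"] by auto
        next
          case False
          then show ?thesis
            using that hardy_lower_integral_zero[OF hardy_lower_wave_0[OF G, of "c * \<delta>" 0]]
            by (simp add: mult_nonpos_nonneg)
        qed
      qed
      then show ?thesis by simp
    qed
    show "g = 0"
    proof (rule oscillation_test_at_infinity[where G="\<lambda>t. G (of_real t)" and \<eta>="A / 2"])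
      show "(\<lambda>t. G (of_real t)) \<in> borel_measurable borel"
        by (rule hardy_lower_measurable[OF G])
      show "0 < A / 2" using A by simp
    qed (fact C[folded G_def] lim[folded G_def] zero)+
  qed
  have inf: "filterlim complex_of_real at_infinity (at_infinity :: real filter)"
    using filterlim_norm_at_top[where 'a=real]
    by (simp add: filterlim_at_infinity_conv_norm_at_top real_norm_def[abs_def])
  have inf': "filterlim (\<lambda>t. complex_of_real t - z) at_infinity (at_infinity :: real filter)" for z
    using tendsto_add_filterlim_at_infinity'[OF inf tendsto_const[of "- z"]] by simp
  have r1: "((\<lambda>t. complex_of_real t / (of_real t - \<i>)) \<longlongrightarrow> 1) (at_infinity :: real filter)"
  proof -
    have "((\<lambda>t. 1 + \<i> / (complex_of_real t - \<i>)) \<longlongrightarrow> 1 + 0) (at_infinity :: real filter)"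
      by (intro tendsto_intros tendsto_divide_0[OF tendsto_const inf'])
    moreover have "1 + \<i> / (complex_of_real t - \<i>) = complex_of_real t / (of_real t - \<i>)" for t
    proof -
      have "complex_of_real t - \<i> \<noteq> 0" by (simp add: complex_eq_iff)
      then show ?thesis by (simp add: field_simps)
    qed
    ultimately show ?thesis by simp
  qed
  have r_le: "norm ((complex_of_real t / (of_real t - \<i>)) ^ 4) \<le> 1" for t
    unfolding norm_power using norm_of_real_minus_i[of t]
    by (intro power_le_one norm_ge_zero) (simp add: norm_divide divide_le_eq_1)
  have w0: "((\<lambda>t::real. wave 0 B (of_real t - of_real q)) \<longlongrightarrow> 1) at_infinity" for q
  proof -
    have "((\<lambda>t::real. exp (\<i> * (of_real B / (of_real t - complex_of_real q)))) \<longlongrightarrow> exp (\<i> * 0)) at_infinity"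
      by (intro tendsto_intros tendsto_divide_0[OF tendsto_const inf'])
    then show ?thesis by (simp add: wave_def)
  qed
  \<comment> \<open>For \<open>e \<noteq> 1\<close> the function \<open>D\<close> tends to \<open>e - 1\<close> at infinity; for \<open>e = 1\<close> it decays like
    \<open>\<i> * B * p / t\<^sup>2\<close>.\<close>
  show False
  proof (cases "e = 1")
    case False
    \<comment> \<open>Since \<open>D\<close> tends to \<open>e - 1\<close>, all four powers of decay
      have to come from this factor.\<close>
    let ?F = "\<lambda>z. 1 / (z - \<i>)\<^sup>2 * (1 / (z - \<i>)\<^sup>2)"
    have F: "of_real t ^ 4 * (?F (of_real t) * D (of_real t)) =
        (of_real t / (of_real t - \<i>)) ^ 4 * D (of_real t)" for t
      by (simp add: power_divide power2_eq_square power4_eq_xxxx)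
    have "e * 1 - 1 = 0"
    proof (rule test[where H="?F" and C=2])
      show "hardy_lower ?F"
      proof (rule hardy_lower_mult[OF hardy_lower_inverse_square, where B=1])
        show "norm (1 / (z - \<i>)\<^sup>2) \<le> 1" if "Im z \<le> 0" for z
        proof -
          have "1 \<le> norm (z - \<i>)" using abs_Im_le_cmod[of "z - \<i>"] that by simp
          then have "1 \<le> norm (z - \<i>) ^ 2" by (rule one_le_power)
          then show ?thesis by (simp add: norm_divide norm_power divide_le_eq_1)
        qed
      qed (use hardy_lower_inverse_square in \<open>auto simp: hardy_lower_def\<close>)
      show "norm (of_real t ^ 4 * (?F (of_real t) * D (of_real t))) \<le> 2" for t
        unfolding F using mult_mono[OF r_le[of t] norm_D[of "of_real t"]] by (simp add: norm_mult)
      have "((\<lambda>t::real. (of_real t / (of_real t - \<i>)) ^ 4 * D (of_real t)) \<longlongrightarrow> 1 ^ 4 * (e * 1 - 1)) at_infinity"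
        unfolding D_def using w0[of p] w0[of 0] by (intro tendsto_intros r1) auto
      then show "((\<lambda>t::real. of_real t ^ 4 * (?F (of_real t) * D (of_real t))) \<longlongrightarrow> e * 1 - 1) at_infinity"
        unfolding F by simp
    qed
    with False show False by simp
  next
    case True
    with nt have Bpos: "B > 0" unfolding e_def by blast
    \<comment> \<open>This factor decays only like \<open>1 / t\<^sup>2\<close>, as \<open>D\<close>
      supplies the other two powers. Its zeros at 0 and \<open>p\<close> cancel the poles of
      \<open>?X\<close>, the phase difference \<open>B / (t - p) - B / t\<close>.\<close>
    let ?F = "\<lambda>z. 1 / (z - \<i>)\<^sup>2 * ((z - of_real 0) / (z - \<i>)) * ((z - of_real p) / (z - \<i>))"
    let ?X = "\<lambda>t. complex_of_real (B * p) / (of_real t * (of_real t - of_real p))"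
    have F: "of_real t ^ 4 * (?F (of_real t) * D (of_real t)) = (of_real t / (of_real t - \<i>)) ^ 4 *
        (of_real (B * p) * (wave 0 B (of_real t) * ((exp (\<i> * ?X t) - 1) / ?X t)))"
      if t: "t \<noteq> 0" "t \<noteq> p" for t
    proof -
      have t': "complex_of_real t \<noteq> 0" "complex_of_real t - of_real p \<noteq> 0"
        using t by auto
      have "wave 0 B (of_real t - of_real p) = wave 0 B (of_real t) * exp (\<i> * ?X t)"
      proof -
        have "of_real B / (of_real t - of_real p) = of_real B / of_real t + ?X t"
          using t' by (simp add: divide_simps) (simp add: algebra_simps)
        then have "wave 0 B (of_real t - of_real p) = exp (\<i> * (of_real B / of_real t + ?X t))"
          by (simp add: wave_def)
        then show ?thesis by (simp add: wave_def distrib_left exp_add)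
      qed
      then have D: "D (of_real t) = wave 0 B (of_real t) * (exp (\<i> * ?X t) - 1)"
        by (simp add: D_def True algebra_simps)
      have X: "of_real t * (of_real t - of_real p) * c = of_real (B * p) * (c / ?X t)" for c
        using t' Bpos p by simp
      have "of_real t ^ 4 * (?F (of_real t) * d) =
         (of_real t / (of_real t - \<i>)) ^ 4 * (of_real t * (of_real t - of_real p) * d)" for d
        by (simp add: power_divide power2_eq_square power4_eq_xxxx)
      then show ?thesis unfolding D X by (simp only: times_divide_eq_right)
    qed
    have "of_real (B * p) * (1 * \<i>) = 0"
    proof (rule test[where H="?F" and C="B * p"])
      show "hardy_lower ?F"
        by (intro hardy_lower_Cayley hardy_lower_inverse_square)
      show "norm (of_real t ^ 4 * (?F (of_real t) * D (of_real t))) \<le> B * p" for t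
      proof (cases "t = 0 \<or> t = p")
        \<comment> \<open>Here \<open>t ^ 4 * ?F\<close> vanishes.\<close>
        case True
        then show ?thesis using Bpos p by auto
      next
        case False
        define x where "x = B * p / (t * (t - p))"
        have X: "?X t = of_real x" by (simp add: x_def)
        \<comment> \<open>The numerator has modulus \<open>2 * \<bar>sin (x / 2)\<bar>\<close>,
          which is at most \<open>\<bar>x\<bar>\<close>.\<close>
        have "norm ((exp (\<i> * ?X t) - 1) / ?X t) \<le> 1"
          unfolding X using dist_exp_i_1[of x] abs_sin_x_le_abs_x[of "x / 2"]
          by (simp add: norm_divide divide_le_eq_1)
        then have "norm (wave 0 B (of_real t) * ((exp (\<i> * ?X t) - 1) / ?X t)) \<le> 1"
          by (simp only: norm_mult norm_wave_of_real mult_1)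
        then have "norm (of_real (B * p) * (wave 0 B (of_real t) * ((exp (\<i> * ?X t) - 1) / ?X t))) \<le> B * p"
          using Bpos p mult_left_le[of "norm (wave 0 B (of_real t) * ((exp (\<i> * ?X t) - 1) / ?X t))" "B * p"]
          by (simp only: norm_mult norm_of_real) simp
        then show ?thesis
          using False mult_mono[OF r_le[of t]] by (subst F) (auto simp: norm_mult)
      qed
      have "((\<lambda>h. (exp (\<i> * h) - 1) / h) \<longlongrightarrow> \<i>) (at (0::complex))"
      proof -
        have "((\<lambda>h. exp (\<i> * h)) has_field_derivative \<i>) (at 0)"
          by (auto intro!: derivative_eq_intros)
        then show ?thesis by (simp add: has_field_derivative_iff)
      qed
      moreover have "filterlim ?X (at 0) at_infinity"
        unfolding filterlim_at
      proof
        show "(?X \<longlongrightarrow> 0) at_infinity"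
          by (intro tendsto_divide_0[OF tendsto_const] filterlim_at_infinity_times inf inf')
        show "\<forall>\<^sub>F t in at_infinity. ?X t \<in> UNIV \<and> ?X t \<noteq> 0"
          using eventually_not_equal_at_infinity[of "0::real"] eventually_not_equal_at_infinity[of p]
          by eventually_elim (use Bpos p in auto)
      qed
      ultimately have "((\<lambda>t. (exp (\<i> * ?X t) - 1) / ?X t) \<longlongrightarrow> \<i>) at_infinity"
        by (rule filterlim_compose)
      then have "((\<lambda>t. (of_real t / (of_real t - \<i>)) ^ 4 * (of_real (B * p) *
          (wave 0 B (of_real t) * ((exp (\<i> * ?X t) - 1) / ?X t)))) \<longlongrightarrow>
          1 ^ 4 * (of_real (B * p) * (1 * \<i>))) at_infinity"
        using w0[of 0] by (intro tendsto_mult tendsto_power r1 tendsto_const) auto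
      moreover have "\<forall>\<^sub>F t in at_infinity. (of_real t / (of_real t - \<i>)) ^ 4 * (of_real (B * p) *
          (wave 0 B (of_real t) * ((exp (\<i> * ?X t) - 1) / ?X t))) =
          of_real t ^ 4 * (?F (of_real t) * D (of_real t))"
        using eventually_not_equal_at_infinity[of "0::real"] eventually_not_equal_at_infinity[of p]
        by eventually_elim (rule F[symmetric], assumption+)
      ultimately have "((\<lambda>t::real. of_real t ^ 4 * (?F (of_real t) * D (of_real t))) \<longlongrightarrow>
          1 ^ 4 * (of_real (B * p) * (1 * \<i>))) at_infinity"
        by (rule Lim_transform_eventually)
      then show "((\<lambda>t::real. of_real t ^ 4 * (?F (of_real t) * D (of_real t))) \<longlongrightarrow>
          of_real (B * p) * (1 * \<i>)) at_infinity"
        by (simp only: power_one mult_1)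
    qed
    with Bpos p show False by simp
  qed
qed

text \<open>A change of variables moves the translation from \<open>F\<close> to the wave. For
  frequencies (0, \<kappa>) the translated and the original wave are both bounded multipliers, so
  each integral vanishes separately; for a \<open>p\<close>-periodic wave the difference itself is
  zero.\<close>

lemma hardy_difference_annihilates:
  fixes p :: real
  assumes F: "hardy_lower F"
  defines "f \<equiv> \<lambda>t. F (of_real (t + p)) - F (of_real t)"
  shows "integrable lborel f"
    and "wave_transform f A B =
      (LINT t|lborel. F (of_real t) * (wave A B (of_real t - of_real p) - wave A B (of_real t)))"
    and "0 \<le> \<kappa> \<Longrightarrow> wave_transform f 0 \<kappa> = 0"
    and "exp (- \<i> * of_real (a * p)) = 1 \<Longrightarrow> wave_transform f a 0 = 0"
proof -
  have int: "integrable lborel (\<lambda>t. F (of_real t))" by (rule hardy_lower_integrable[OF F])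
  have int_p: "integrable lborel (\<lambda>t. F (of_real (t + p)))"
    using lborel_integrable_real_affine[OF int, of 1 p] by (simp add: add.commute)
  with int show "integrable lborel f" by (simp add: f_def)
  have w1: "norm (wave A B (of_real t - of_real p)) = 1" for A B t
    using norm_wave_of_real[of A B "t - p"] by simp
  have wm [measurable]: "(\<lambda>t. wave A B (of_real t - of_real p)) \<in> borel_measurable borel" for A B
    unfolding wave_def by measurable
  have [measurable]: "(\<lambda>t. F (of_real t)) \<in> borel_measurable borel"
    by (rule hardy_lower_measurable[OF F])
  have int_w: "integrable lborel (\<lambda>t. F (of_real t) * wave A B (of_real t - of_real p))" for A B
    by (rule Bochner_Integration.integrable_bound[OF int]) (auto simp: norm_mult w1)
  show *: "wave_transform f A B =
      (LINT t|lborel. F (of_real t) * (wave A B (of_real t - of_real p) - wave A B (of_real t)))" for A B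
  proof -
    have "(LINT t|lborel. F (of_real (t + p)) * wave A B (of_real t)) =
        (LINT t|lborel. F (of_real t) * wave A B (of_real t - of_real p))"
      by (subst lborel_integral_real_affine[where c=1 and t="- p"]) (simp_all add: add.commute)
    then show ?thesis
      using integrable_mult_wave[OF int_p] integrable_mult_wave[OF int] int_w
      by (simp add: wave_transform_def f_def left_diff_distrib right_diff_distrib)
  qed
  show "wave_transform f 0 \<kappa> = 0" if "0 \<le> \<kappa>"
    using hardy_lower_integral_zero[OF hardy_lower_wave[OF F _ that, of 0 p]]
      hardy_lower_integral_zero[OF hardy_lower_wave_0[OF F _ that, of 0]]
      integrable_mult_wave[OF int] int_w
    by (simp add: * right_diff_distrib)
  show "wave_transform f a 0 = 0" if "exp (- \<i> * of_real (a * p)) = 1"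
    unfolding * wave_shift that by simp
qed

text \<open>A single \<open>f\<close> kills the whole lattice on the first axis and the closed
  half-axis \<open>\<kappa> \<ge> 0\<close> on the second. On the line \<open>B = 0\<close> lattice
  points must be excluded, because periodicity kills them for every choice of
  \<open>F\<close>.\<close>

lemma annihilator_exists:
  assumes \<alpha>: "\<alpha> > 0"
    and AB: "B < 0 \<or> A > 0 \<and> B \<ge> 0 \<and> (B > 0 \<or> (\<forall>m::int. A \<noteq> pi * (\<alpha> * of_int m)))"
  shows "\<exists>f. integrable lborel f \<and> (\<forall>j::int. wave_transform f (pi * (\<alpha> * of_int j)) 0 = 0) \<and>
    (\<forall>\<kappa>\<ge>0. wave_transform f 0 \<kappa> = 0) \<and> wave_transform f A B \<noteq> 0"
proof -
  \<comment> \<open>With this shift \<open>exp (- \<i> * a * p) = 1\<close> holds exactly for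
    \<open>a\<close> in the integer multiples of pi \<alpha>.\<close>
  define p where "p = 2 / \<alpha>"
  have p: "p > 0" using \<alpha> by (simp add: p_def)
  have period: "exp (- \<i> * of_real (a * p)) = 1 \<longleftrightarrow> (\<exists>m::int. a = pi * (\<alpha> * of_int m))" for a
  proof -
    have "exp (- \<i> * of_real (a * p)) = 1 \<longleftrightarrow> (\<exists>n::int. - (a * p) = of_int (2 * n) * pi)"
      by (simp add: exp_eq_1)
    also have "\<dots> \<longleftrightarrow> (\<exists>n::int. a = pi * (\<alpha> * of_int (- n)))"
      using \<alpha> by (intro arg_cong[where f=Ex] ext) (auto simp: p_def field_simps)
    also have "\<dots> \<longleftrightarrow> (\<exists>m::int. a = pi * (\<alpha> * of_int m))"
    proof
      assume "\<exists>m::int. a = pi * (\<alpha> * of_int m)"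
      then obtain m :: int where "a = pi * (\<alpha> * of_int m)" by blast
      then show "\<exists>n::int. a = pi * (\<alpha> * of_int (- n))" by (intro exI[of _ "- m"]) simp
    qed blast
    finally show ?thesis .
  qed
  have "\<exists>F. hardy_lower F \<and>
    (LINT t|lborel. F (of_real t) * (wave A B (of_real t - of_real p) - wave A B (of_real t))) \<noteq> 0"
  proof (cases "B < 0")
    case True
    then show ?thesis using p by (rule hardy_pairing_negative)
  next
    case False
    with AB have AB': "A > 0" "B \<ge> 0" "B > 0 \<or> (\<forall>m::int. A \<noteq> pi * (\<alpha> * of_int m))" by auto
    then show ?thesis using p period[of A] by (intro hardy_pairing_positive) auto
  qed
  then obtain F where F: "hardy_lower F"
    and nz: "(LINT t|lborel. F (of_real t) * (wave A B (of_real t - of_real p) - wave A B (of_real t))) \<noteq> 0"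
    by blast
  note f = hardy_difference_annihilates[OF F, where p=p]
  show ?thesis
  proof (intro exI conjI allI impI)
    show "integrable lborel (\<lambda>t. F (of_real (t + p)) - F (of_real t))" by (rule f(1))
    show "wave_transform (\<lambda>t. F (of_real (t + p)) - F (of_real t)) (pi * (\<alpha> * of_int j)) 0 = 0" for j :: int
      by (rule f(4)) (use period in blast)
    show "wave_transform (\<lambda>t. F (of_real (t + p)) - F (of_real t)) 0 \<kappa> = 0" if "0 \<le> \<kappa>" for \<kappa>
      using that by (rule f(3))
    show "wave_transform (\<lambda>t. F (of_real (t + p)) - F (of_real t)) A B \<noteq> 0"
      unfolding f(2) by (rule nz)
  qed
qed

section \<open>Symmetries of the wave transform and annihilators of the cross\<close>

text \<open>The map \<open>s \<mapsto> c / s\<close> is a bijection of the punctured line onto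
  itself, with Jacobian \<open>c / s\<^sup>2\<close>.\<close>

lemma integral_inversion:
  fixes g :: "real \<Rightarrow> complex"
  assumes c: "c > 0" and g: "integrable lborel g"
  shows "integrable lborel (\<lambda>s. (c / s\<^sup>2) *\<^sub>R g (c / s))"
    and "(LINT s|lborel. (c / s\<^sup>2) *\<^sub>R g (c / s)) = (LINT t|lborel. g t)"
proof -
  let ?S = "- {0 :: real}"
  let ?h = "\<lambda>s. (c / s\<^sup>2) *\<^sub>R g (c / s)"
  have [measurable]: "g \<in> borel_measurable borel" using g by auto
  \<comment> \<open>Change of variables is applied to absolute integrability on a set, so integrals
    over \<open>lborel\<close> are transferred to the punctured line and back; the removed origin is
    a null set.\<close>
  have conv1: "integrable lborel f \<longleftrightarrow> f absolutely_integrable_on ?S"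
      and conv2: "f absolutely_integrable_on ?S \<Longrightarrow> integral ?S f = (LINT t|lborel. f t)"
    if [measurable]: "f \<in> borel_measurable borel" for f :: "real \<Rightarrow> complex"
  proof -
    have nz: "AE t in lborel. t \<noteq> (0::real)" by (rule AE_lborel_singleton)
    have meas: "(\<lambda>t. indicator ?S t *\<^sub>R f t) \<in> borel_measurable lborel" by measurable
    have "f absolutely_integrable_on ?S \<longleftrightarrow> integrable lborel (\<lambda>t. indicator ?S t *\<^sub>R f t)"
      unfolding set_integrable_def using integrable_completion[OF meas] by simp
    also have "\<dots> \<longleftrightarrow> integrable lborel f"
      by (rule integrable_cong_AE) (use nz in \<open>auto elim!: eventually_mono\<close>)
    finally show "integrable lborel f \<longleftrightarrow> f absolutely_integrable_on ?S" ..
    assume "f absolutely_integrable_on ?S"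
    then have "integral ?S f = (LINT t:?S|lebesgue. f t)"
      by (simp add: set_lebesgue_integral_eq_integral)
    also have "\<dots> = (LINT t|lborel. indicator ?S t *\<^sub>R f t)"
      unfolding set_lebesgue_integral_def by (rule integral_completion[OF meas])
    also have "\<dots> = (LINT t|lborel. f t)"
      by (rule integral_cong_AE) (use nz in \<open>auto elim!: eventually_mono\<close>)
    finally show "integral ?S f = (LINT t|lborel. f t)" .
  qed
  have hm: "?h \<in> borel_measurable borel" by measurable
  have im: "(\<lambda>s. c / s) ` ?S = ?S"
  proof
    show "?S \<subseteq> (\<lambda>s. c / s) ` ?S"
    proof
      fix x assume "x \<in> ?S"
      then show "x \<in> (\<lambda>s. c / s) ` ?S" using c by (intro image_eqI[of _ _ "c / x"]) auto
    qed
  qed (use c in auto)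
  have gi: "g absolutely_integrable_on ?S"
    using conv1[of g] g by simp
  have "integral ?S g = (LINT t|lborel. g t)"
    by (rule conv2[OF _ gi]) measurable
  moreover have "(\<lambda>s. \<bar>- c / s\<^sup>2\<bar> *\<^sub>R g (c / s)) absolutely_integrable_on ?S \<and>
      integral ?S (\<lambda>s. \<bar>- c / s\<^sup>2\<bar> *\<^sub>R g (c / s)) = (LINT t|lborel. g t) \<longleftrightarrow>
      g absolutely_integrable_on ((\<lambda>s. c / s) ` ?S) \<and> integral ((\<lambda>s. c / s) ` ?S) g = (LINT t|lborel. g t)"
  proof (rule has_absolute_integral_change_of_variables_real)
    show "((\<lambda>s. c / s) has_real_derivative - c / x\<^sup>2) (at x within ?S)" if "x \<in> ?S" for x
      using that by (auto intro!: derivative_eq_intros simp: power2_eq_square)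
    show "inj_on (\<lambda>s. c / s) ?S" using c by (auto simp: inj_on_def)
  qed auto
  moreover have "(\<lambda>s. \<bar>- c / s\<^sup>2\<bar> *\<^sub>R g (c / s)) = ?h" using c by simp
  ultimately have "?h absolutely_integrable_on ?S \<and> integral ?S ?h = (LINT t|lborel. g t)"
    using gi unfolding im by simp
  then show "integrable lborel ?h" "(LINT s|lborel. ?h s) = (LINT t|lborel. g t)"
    using conv1[OF hm] conv2[OF hm] by auto
qed

text \<open>At \<open>t = c / s\<close> the phase \<open>b * t + c * a / t\<close> reads
  \<open>a * s + c * b / s\<close>, so inversion swaps the two axes of frequencies.\<close>

lemma wave_transform_inversion:
  assumes c: "c > 0" and f: "integrable lborel f"
  shows "integrable lborel (\<lambda>s. (c / s\<^sup>2) *\<^sub>R f (c / s))"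
    and "wave_transform (\<lambda>s. (c / s\<^sup>2) *\<^sub>R f (c / s)) a (c * b) = wave_transform f b (c * a)"
proof -
  show "integrable lborel (\<lambda>s. (c / s\<^sup>2) *\<^sub>R f (c / s))"
    by (rule integral_inversion(1)[OF c f])
  have "wave b (c * a) (of_real (c / s)) = wave a (c * b) (of_real s)" for s
    using c by (simp add: wave_def add.commute mult.commute)
  then show "wave_transform (\<lambda>s. (c / s\<^sup>2) *\<^sub>R f (c / s)) a (c * b) = wave_transform f b (c * a)"
    using integral_inversion(2)[OF c integrable_mult_wave[OF f], of b "c * a"]
    by (simp add: wave_transform_def)
qed

lemma wave_transform_reflection:
  assumes f: "integrable lborel f"
  shows "integrable lborel (\<lambda>t. f (- t))"
    and "wave_transform (\<lambda>t. f (- t)) a b = wave_transform f (- a) (- b)"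
proof -
  show "integrable lborel (\<lambda>t. f (- t))"
    using lborel_integrable_real_affine[OF f, of "-1" 0] by simp
  show "wave_transform (\<lambda>t. f (- t)) a b = wave_transform f (- a) (- b)"
    unfolding wave_transform_def
    by (subst lborel_integral_real_affine[where c="-1" and t=0]) (simp_all add: wave_def)
qed

lemma cross_annihilator_exists:
  assumes \<alpha>: "\<alpha> > 0" and \<beta>: "\<beta> > 0" and c: "c > 0" and \<xi>: "(x, y) \<notin> Lambda_pp \<alpha> \<beta>"
  shows "\<exists>f. integrable lborel f \<and>
    (\<forall>(a, b) \<in> Lambda_pp \<alpha> \<beta>. wave_transform f (pi * a) (c * (pi * b)) = 0) \<and>
    wave_transform f (pi * x) (c * (pi * y)) \<noteq> 0"
proof -
  have nx: "x \<noteq> \<alpha> * of_int j" if "y = 0" "j \<ge> 0" for j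
    using \<xi> that by (auto simp: Lambda_pp_def)
  have ny: "y \<noteq> \<beta> * of_int k" if "x = 0" "k \<ge> 1" for k
    using \<xi> that by (auto simp: Lambda_pp_def)
  have "x \<noteq> 0 \<or> y \<noteq> 0" using nx[of 0] by auto
  \<comment> \<open>These overlapping regions miss only the origin, which belongs to the cross
    through \<open>j = 0\<close>. The second is the first with the axes swapped.\<close>
  then consider "y < 0 \<or> x > 0 \<and> y \<ge> 0" | "x < 0 \<or> y > 0 \<and> x \<ge> 0" by linarith
  then show ?thesis
  proof cases
    case 1
    have "y > 0 \<or> (\<forall>m::int. pi * x \<noteq> pi * (\<alpha> * of_int m))" if "x > 0" "y \<ge> 0"
    proof (cases "y = 0")
      case True
      \<comment> \<open>Multiples with \<open>m \<ge> 0\<close> are excluded because the point lies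
        off the cross, negative ones by \<open>x > 0\<close>.\<close>
      have "x \<noteq> \<alpha> * of_int m" for m :: int
        using nx[OF True, of m] that(1) \<alpha> zero_less_mult_iff[of \<alpha> "of_int m"] by (cases "m \<ge> 0") auto
      then show ?thesis by simp
    qed (use that in auto)
    then have "c * (pi * y) < 0 \<or> pi * x > 0 \<and> c * (pi * y) \<ge> 0 \<and>
        (c * (pi * y) > 0 \<or> (\<forall>m::int. pi * x \<noteq> pi * (\<alpha> * of_int m)))"
      using 1 c by (auto simp: mult_less_0_iff zero_less_mult_iff)
    from annihilator_exists[OF \<alpha> this] obtain f where f: "integrable lborel f"
      "\<And>j::int. wave_transform f (pi * (\<alpha> * of_int j)) 0 = 0"
      "\<And>\<kappa>. 0 \<le> \<kappa> \<Longrightarrow> wave_transform f 0 \<kappa> = 0"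
      "wave_transform f (pi * x) (c * (pi * y)) \<noteq> 0" by blast
    have "wave_transform f (pi * a) (c * (pi * b)) = 0" if "(a, b) \<in> Lambda_pp \<alpha> \<beta>" for a b
      using that f(2,3) \<beta> c by (auto simp: Lambda_pp_def)
    with f show ?thesis by (intro exI[of _ f]) auto
  next
    case 2
    have "x > 0 \<or> (\<forall>m::int. pi * y \<noteq> pi * (\<beta> * of_int m))" if "y > 0" "x \<ge> 0"
    proof (cases "x = 0")
      case True
      have "y \<noteq> \<beta> * of_int m" for m :: int
        using ny[OF True, of m] that(1) \<beta> zero_less_mult_iff[of \<beta> "of_int m"] by (cases "m \<ge> 1") auto
      then show ?thesis by simp
    qed (use that in auto)
    then have "c * (pi * x) < 0 \<or> pi * y > 0 \<and> c * (pi * x) \<ge> 0 \<and>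
        (c * (pi * x) > 0 \<or> (\<forall>m::int. pi * y \<noteq> pi * (\<beta> * of_int m)))"
      using 2 c by (auto simp: mult_less_0_iff zero_less_mult_iff)
    from annihilator_exists[OF \<beta> this] obtain f where f: "integrable lborel f"
      "\<And>j::int. wave_transform f (pi * (\<beta> * of_int j)) 0 = 0"
      "\<And>\<kappa>. 0 \<le> \<kappa> \<Longrightarrow> wave_transform f 0 \<kappa> = 0"
      "wave_transform f (pi * y) (c * (pi * x)) \<noteq> 0" by blast
    let ?g = "\<lambda>s. (c / s\<^sup>2) *\<^sub>R f (c / s)"
    note g = wave_transform_inversion[OF c f(1)]
    have "wave_transform ?g (pi * a) (c * (pi * b)) = 0" if "(a, b) \<in> Lambda_pp \<alpha> \<beta>" for a b
      unfolding g(2) using that f(2,3) \<alpha> c by (auto simp: Lambda_pp_def)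
    with f(4) g show ?thesis by (intro exI[of _ ?g]) auto
  qed
qed

section \<open>Measures carried by the hyperbola\<close>

text \<open>The density refers to the parameter rather than to arc length, which spares dividing by
  the speed. The general codomain serves real densities in the Jordan decomposition and complex ones
  elsewhere.\<close>

definition curve_measure :: "(real \<Rightarrow> 'a) \<Rightarrow> (real \<Rightarrow> 'b) \<Rightarrow> 'a set \<Rightarrow> 'b::{banach, second_countable_topology}" where
  "curve_measure \<gamma> f A = (LINT t|lborel. indicator A (\<gamma> t) *\<^sub>R f t)"

context
  fixes N :: "'a measure" and \<gamma> :: "real \<Rightarrow> 'a" and proj :: "'a \<Rightarrow> real"
  assumes \<gamma> [measurable]: "\<gamma> \<in> borel \<rightarrow>\<^sub>M N" and proj [measurable]: "proj \<in> N \<rightarrow>\<^sub>M borel"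
    and inv: "\<And>t. proj (\<gamma> t) = t"
begin

lemma integrable_indicator_curve:
  fixes f :: "real \<Rightarrow> 'b::{banach, second_countable_topology}"
  assumes f: "integrable lborel f" and [measurable]: "A \<in> sets N"
  shows "integrable lborel (\<lambda>t. indicator A (\<gamma> t) *\<^sub>R f t)"
proof -
  have [measurable]: "f \<in> borel_measurable borel" using f by auto
  show ?thesis
    by (rule Bochner_Integration.integrable_bound[OF f]) (auto split: split_indicator)
qed

text \<open>The Hahn set is explicit: the supremum is attained on the part of \<open>A\<close> where
  \<open>h (proj x) > 0\<close>. The measurable left inverse \<open>proj\<close> is what turns the
  sign of the density into a measurable subset of the target space.\<close>

lemma pos_variation_curve_measure:
  fixes h :: "real \<Rightarrow> real"
  assumes h: "integrable lborel h"
  shows "pos_variation N (curve_measure \<gamma> h) = distr (density lborel (\<lambda>t. ennreal (h t))) N \<gamma>"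
proof -
  let ?D = "distr (density lborel (\<lambda>t. ennreal (h t))) N \<gamma>"
  have [measurable]: "h \<in> borel_measurable borel" using h by auto
  have int: "integrable lborel (\<lambda>t. indicator A (\<gamma> t) * max 0 (h t))" if "A \<in> sets N" for A
    using integrable_indicator_curve[OF integrable_max[OF integrable_zero h] that] by simp
  have D: "emeasure ?D A = ennreal (LINT t|lborel. indicator A (\<gamma> t) * max 0 (h t))"
    if [measurable]: "A \<in> sets N" for A
  proof -
    have "emeasure ?D A = (\<integral>\<^sup>+t. ennreal (h t) * indicator (\<gamma> -` A) t \<partial>lborel)"
      using measurable_sets[OF \<gamma> that] by (simp add: emeasure_distr emeasure_density)
    also have "\<dots> = (\<integral>\<^sup>+t. ennreal (indicator A (\<gamma> t) * max 0 (h t)) \<partial>lborel)"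
      by (intro nn_integral_cong) (auto split: split_indicator simp: max_def ennreal_neg)
    also have "\<dots> = ennreal (LINT t|lborel. indicator A (\<gamma> t) * max 0 (h t))"
      by (rule nn_integral_eq_integral[OF int[OF that]]) auto
    finally show ?thesis .
  qed
  have "(SUP B\<in>{B \<in> sets N. B \<subseteq> A}. ennreal (curve_measure \<gamma> h B)) = emeasure ?D A"
    if A[measurable]: "A \<in> sets N" for A
  proof (rule antisym)
    show "(SUP B\<in>{B \<in> sets N. B \<subseteq> A}. ennreal (curve_measure \<gamma> h B)) \<le> emeasure ?D A"
    proof (rule SUP_least)
      fix B assume "B \<in> {B \<in> sets N. B \<subseteq> A}"
      then have B: "B \<in> sets N" "B \<subseteq> A" by auto
      have "curve_measure \<gamma> h B \<le> (LINT t|lborel. indicator A (\<gamma> t) * max 0 (h t))"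
        unfolding curve_measure_def
        by (rule integral_mono[OF integrable_indicator_curve[OF h B(1)] int[OF A]])
           (use B in \<open>auto split: split_indicator\<close>)
      then show "ennreal (curve_measure \<gamma> h B) \<le> emeasure ?D A"
        unfolding D[OF A] by (rule ennreal_leI)
    qed
    let ?B = "A \<inter> {x \<in> space N. h (proj x) > 0}"
    have B: "?B \<in> sets N" by measurable
    have "emeasure ?D A = ennreal (curve_measure \<gamma> h ?B)"
      unfolding D[OF A] curve_measure_def
      by (intro arg_cong[where f=ennreal] Bochner_Integration.integral_cong)
         (use measurable_space[OF \<gamma>] in \<open>auto split: split_indicator simp: inv\<close>)
    also have "\<dots> \<le> (SUP B\<in>{B \<in> sets N. B \<subseteq> A}. ennreal (curve_measure \<gamma> h B))"
      using B by (intro SUP_upper) auto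
    finally show "emeasure ?D A \<le> \<dots>" .
  qed
  then have "pos_variation N (curve_measure \<gamma> h) = measure_of (space N) (sets N) (emeasure ?D)"
    unfolding pos_variation_def
    by (intro measure_of_eq sets.space_closed) (simp add: sets.sigma_sets_eq)
  also have "\<dots> = ?D"
    using measure_of_of_measure[of ?D] by simp
  finally show ?thesis .
qed

lemma signed_integral_curve_measure:
  assumes h: "integrable lborel h"
    and \<phi> [measurable]: "\<phi> \<in> borel_measurable N" and bnd: "\<And>x. norm (\<phi> x) \<le> C"
  shows "signed_integral N (curve_measure \<gamma> h) \<phi> = (LINT t|lborel. h t *\<^sub>R \<phi> (\<gamma> t))"
proof -
  have [measurable]: "h \<in> borel_measurable borel" using h by auto
  have int: "integrable lborel (\<lambda>t. k t *\<^sub>R \<phi> (\<gamma> t))" if k: "integrable lborel k" for k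
  proof -
    have [measurable]: "k \<in> borel_measurable borel" using k by auto
    show ?thesis
      by (rule Bochner_Integration.integrable_bound[OF integrable_mult_right[OF k, of C]])
         (auto simp: abs_mult mult.commute[of C] intro!: mult_left_mono order_trans[OF bnd abs_ge_self])
  qed
  have *: "integral\<^sup>L (pos_variation N (curve_measure \<gamma> k)) \<phi> = (LINT t|lborel. max 0 (k t) *\<^sub>R \<phi> (\<gamma> t))"
    if k: "integrable lborel k" for k
  proof -
    have [measurable]: "k \<in> borel_measurable borel" using k by auto
    have "(\<lambda>t. ennreal (k t)) = (\<lambda>t. ennreal (max 0 (k t)))"
      by (auto simp: max_def ennreal_neg)
    then have "integral\<^sup>L (pos_variation N (curve_measure \<gamma> k)) \<phi> =
        integral\<^sup>L (density lborel (\<lambda>t. ennreal (max 0 (k t)))) (\<lambda>t. \<phi> (\<gamma> t))"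
      by (simp add: pos_variation_curve_measure[OF k] integral_distr)
    also have "\<dots> = (LINT t|lborel. max 0 (k t) *\<^sub>R \<phi> (\<gamma> t))"
      by (rule integral_density) auto
    finally show ?thesis .
  qed
  have "(\<lambda>A. - curve_measure \<gamma> h A) = curve_measure \<gamma> (\<lambda>t. - h t)"
    by (simp add: curve_measure_def[abs_def])
  then have "signed_integral N (curve_measure \<gamma> h) \<phi> =
      (LINT t|lborel. max 0 (h t) *\<^sub>R \<phi> (\<gamma> t)) - (LINT t|lborel. max 0 (- h t) *\<^sub>R \<phi> (\<gamma> t))"
    unfolding signed_integral_def using *[OF h] *[of "\<lambda>t. - h t"] h by simp
  also have "\<dots> = (LINT t|lborel. max 0 (h t) *\<^sub>R \<phi> (\<gamma> t) - max 0 (- h t) *\<^sub>R \<phi> (\<gamma> t))"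
    using h by (intro Bochner_Integration.integral_diff[symmetric] int integrable_max) auto
  also have "\<dots> = (LINT t|lborel. h t *\<^sub>R \<phi> (\<gamma> t))"
    by (intro Bochner_Integration.integral_cong) (auto simp: max_def)
  finally show ?thesis .
qed

lemma complex_measure_integral_curve_measure:
  assumes f: "integrable lborel f"
    and \<phi> [measurable]: "\<phi> \<in> borel_measurable N" and bnd: "\<And>x. norm (\<phi> x) \<le> C"
  shows "complex_measure_integral N (curve_measure \<gamma> f) \<phi> = (LINT t|lborel. f t * \<phi> (\<gamma> t))"
proof -
  have [measurable]: "f \<in> borel_measurable borel" using f by auto
  have fs: "integrable lborel (\<lambda>t. Re (f t))" "integrable lborel (\<lambda>t. Im (f t))" using f by auto
  have int: "integrable lborel (\<lambda>t. f t * \<phi> (\<gamma> t))"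
    by (rule Bochner_Integration.integrable_bound[OF integrable_mult_right[OF f, of "of_real C"]])
       (auto simp: norm_mult mult.commute[of "\<bar>C\<bar>"] intro!: mult_left_mono order_trans[OF bnd abs_ge_self])
  have int': "integrable lborel (\<lambda>t. k t *\<^sub>R \<phi> (\<gamma> t))" if k: "integrable lborel k" for k :: "real \<Rightarrow> real"
  proof -
    have [measurable]: "k \<in> borel_measurable borel" using k by auto
    show ?thesis
      by (rule Bochner_Integration.integrable_bound[OF integrable_mult_right[OF k, of C]])
         (auto simp: abs_mult mult.commute[of C] intro!: mult_left_mono order_trans[OF bnd abs_ge_self])
  qed
  have A: "Re (curve_measure \<gamma> f A) = curve_measure \<gamma> (\<lambda>t. Re (f t)) A"
      "Im (curve_measure \<gamma> f A) = curve_measure \<gamma> (\<lambda>t. Im (f t)) A" if "A \<in> sets N" for A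
    using integrable_indicator_curve[OF f that]
    by (simp_all add: curve_measure_def flip: integral_Re integral_Im)
  \<comment> \<open>Real and imaginary parts were identified on measurable sets only;
    \<open>pos_variation\<close> looks at no other sets.\<close>
  have cong: "signed_integral N \<rho> \<phi> = signed_integral N \<rho>' \<phi>" if "\<And>A. A \<in> sets N \<Longrightarrow> \<rho> A = \<rho>' A" for \<rho> \<rho>'
  proof -
    have "pos_variation N \<sigma> = pos_variation N \<sigma>'" if "\<And>A. A \<in> sets N \<Longrightarrow> \<sigma> A = \<sigma>' A" for \<sigma> \<sigma>'
      unfolding pos_variation_def
      by (intro measure_of_eq sets.space_closed SUP_cong) (auto simp: that)
    then show ?thesis unfolding signed_integral_def using that by metis
  qed
  have "complex_measure_integral N (curve_measure \<gamma> f) \<phi> =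
      (LINT t|lborel. Re (f t) *\<^sub>R \<phi> (\<gamma> t)) + \<i> * (LINT t|lborel. Im (f t) *\<^sub>R \<phi> (\<gamma> t))"
    unfolding complex_measure_integral_def
    using cong[OF A(1)] cong[OF A(2)] signed_integral_curve_measure[OF fs(1) \<phi> bnd]
      signed_integral_curve_measure[OF fs(2) \<phi> bnd] by simp
  also have "\<dots> = (LINT t|lborel. Re (f t) *\<^sub>R \<phi> (\<gamma> t) + \<i> * (Im (f t) *\<^sub>R \<phi> (\<gamma> t)))"
    by (simp only: integral_mult_right_zero
        Bochner_Integration.integral_add[OF int'[OF fs(1)] integrable_mult_right[OF int'[OF fs(2)]]])
  also have "\<dots> = (LINT t|lborel. f t * \<phi> (\<gamma> t))"
    by (intro Bochner_Integration.integral_cong) (auto simp: complex_eq_iff algebra_simps)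
  finally show ?thesis .
qed

text \<open>Dominated convergence for the partial sums, with majorant \<open>norm (f t)\<close>:
  disjointness keeps every partial sum of indicators at most 1.\<close>

lemma complex_measure_curve_measure:
  assumes f: "integrable lborel f"
  shows "complex_measure N (curve_measure \<gamma> f)"
  unfolding complex_measure_def
proof (intro conjI allI impI)
  show "curve_measure \<gamma> f {} = 0" by (simp add: curve_measure_def)
  fix A :: "nat \<Rightarrow> 'a set" assume A: "range A \<subseteq> sets N" "disjoint_family A"
  have [measurable]: "f \<in> borel_measurable borel" using f by auto
  have An [measurable]: "A n \<in> sets N" for n using A by auto
  have "(\<lambda>n. LINT t|lborel. (\<Sum>i<n. indicator (A i) (\<gamma> t) *\<^sub>R f t)) \<longlonglongrightarrow>
      (LINT t|lborel. indicator (\<Union>i. A i) (\<gamma> t) *\<^sub>R f t)"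
  proof (rule integral_dominated_convergence)
    show "integrable lborel (\<lambda>t. norm (f t))" using f by simp
    have sums: "(\<lambda>i. indicator (A i) x) sums (indicator (\<Union>i. A i) x :: real)" for x
      by (rule indicator_sums) (use A(2) in \<open>auto simp: disjoint_family_on_def\<close>)
    show "AE t in lborel. (\<lambda>n. \<Sum>i<n. indicator (A i) (\<gamma> t) *\<^sub>R f t) \<longlonglongrightarrow>
        indicator (\<Union>i. A i) (\<gamma> t) *\<^sub>R f t"
      using sums_scaleR_left[OF sums] unfolding sums_def by (intro AE_I2)
    show "AE t in lborel. norm (\<Sum>i<n. indicator (A i) (\<gamma> t) *\<^sub>R f t) \<le> norm (f t)" for n
    proof (rule AE_I2)
      fix t
      have "(\<Sum>i<n. indicator (A i) (\<gamma> t)) \<le> (indicator (\<Union>i. A i) (\<gamma> t) :: real)"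
        using sum_le_suminf[OF sums_summable[OF sums[of "\<gamma> t"]], of "{..<n}"] sums_unique[OF sums[of "\<gamma> t"]]
        by simp
      also have "\<dots> \<le> 1" by (simp add: indicator_def)
      finally have "\<bar>\<Sum>i<n. indicator (A i) (\<gamma> t)\<bar> \<le> (1::real)"
        by (simp add: abs_of_nonneg sum_nonneg)
      then show "norm (\<Sum>i<n. indicator (A i) (\<gamma> t) *\<^sub>R f t) \<le> norm (f t)"
        unfolding scaleR_sum_left[symmetric] norm_scaleR by (rule mult_left_le_one_le[rotated 2]) auto
    qed
    show "(\<lambda>t. indicator (\<Union>i. A i) (\<gamma> t) *\<^sub>R f t) \<in> borel_measurable lborel"
      by (intro borel_measurable_integrable integrable_indicator_curve f) auto
    show "(\<lambda>t. \<Sum>i<n. indicator (A i) (\<gamma> t) *\<^sub>R f t) \<in> borel_measurable lborel" for n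
      by (intro borel_measurable_sum borel_measurable_integrable integrable_indicator_curve f An)
  qed
  moreover have "(LINT t|lborel. (\<Sum>i<n. indicator (A i) (\<gamma> t) *\<^sub>R f t)) =
      (\<Sum>i<n. curve_measure \<gamma> f (A i))" for n
    unfolding curve_measure_def
    by (intro Bochner_Integration.integral_sum integrable_indicator_curve f An)
  ultimately show "(\<lambda>n. curve_measure \<gamma> f (A n)) sums curve_measure \<gamma> f (\<Union>n. A n)"
    by (simp only: sums_def curve_measure_def)
qed

end

section \<open>Fourier transforms and absolute continuity on the hyperbola\<close>

lemma hyperbola_param_measurable [measurable]: "hyperbola_param M \<in> borel_measurable borel"
  unfolding hyperbola_param_def borel_prod[symmetric] by measurable

lemma fst_hyperbola_param: "fst (hyperbola_param M t) = t"
  by (simp add: hyperbola_param_def)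

text \<open>The character pulled back along the parametrization is a wave. This holds even at
  \<open>t = 0\<close>, where division by zero gives the point (0, 0) and both sides equal
  1.\<close>

lemma fourier_curve_measure:
  assumes "integrable lborel f"
  shows "fourier (curve_measure (hyperbola_param M) f) (x, y) =
    wave_transform f (pi * x) (M\<^sup>2 / (4 * pi\<^sup>2) * (pi * y))"
proof -
  have "fst \<in> borel_measurable (borel :: (real \<times> real) measure)"
    by (intro borel_measurable_continuous_onI continuous_intros)
  moreover have "(\<lambda>z. exp (\<i> * of_real (pi * (z \<bullet> (x, y))))) \<in> borel_measurable borel"
    by (intro borel_measurable_continuous_onI continuous_intros)
  ultimately have "fourier (curve_measure (hyperbola_param M) f) (x, y) =
      (LINT t|lborel. f t * exp (\<i> * of_real (pi * (hyperbola_param M t \<bullet> (x, y)))))"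
    unfolding fourier_def
    by (intro complex_measure_integral_curve_measure[where proj=fst and C=1] hyperbola_param_measurable
        fst_hyperbola_param assms) (simp_all del: of_real_mult)
  moreover have "exp (\<i> * of_real (pi * (hyperbola_param M t \<bullet> (x, y)))) =
      wave (pi * x) (M\<^sup>2 / (4 * pi\<^sup>2) * (pi * y)) (of_real t)" for t
    by (simp add: wave_def hyperbola_param_def algebra_simps)
  ultimately show ?thesis by (simp only: wave_transform_def)
qed

text \<open>The speed is positive off 0, since the first component of the derivative is 1; hence
  sets of zero arc length have Lebesgue null preimages.\<close>

lemma hyperbola_arc_length_null_sets:
  assumes "A \<in> null_sets (hyperbola_arc_length M)"
  shows "AE t in lborel. hyperbola_param M t \<notin> A"
proof -
  let ?d = "\<lambda>t. ennreal (norm (vector_derivative (hyperbola_param M) (at t))) * indicator (- {0}) t"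
  have deriv: "vector_derivative (hyperbola_param M) (at t) = (1, - (M\<^sup>2 / (4 * pi\<^sup>2)) / t\<^sup>2)"
    if "t \<noteq> 0" for t
    unfolding hyperbola_param_def
    by (rule vector_derivative_at)
       (use that in \<open>auto intro!: derivative_eq_intros has_vector_derivative_Pair
          simp: has_real_derivative_iff_has_vector_derivative[symmetric] field_simps power2_eq_square\<close>)
  have d: "?d = (\<lambda>t. ennreal (sqrt (1 + ((M\<^sup>2 / (4 * pi\<^sup>2)) / t\<^sup>2)\<^sup>2)) * indicator (- {0}) t)"
    by (rule ext) (auto simp: deriv norm_Pair split: split_indicator)
  have [measurable]: "?d \<in> borel_measurable borel" unfolding d by measurable
  have pos: "?d t \<noteq> 0" if "t \<noteq> 0" for t
    using that by (simp add: deriv zero_prod_def)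
  have "hyperbola_param M -` A \<in> null_sets (density lborel ?d)"
    using assms unfolding hyperbola_arc_length_def arc_length_measure_def
    by (subst (asm) null_sets_distr_iff) auto
  then have "AE t in lborel. t \<in> hyperbola_param M -` A \<longrightarrow> ?d t = 0"
    by (subst (asm) null_sets_density_iff) auto
  with AE_lborel_singleton[of 0] show ?thesis
    by eventually_elim (use pos in auto)
qed

text \<open>Both vanishing conditions reduce to sets that the parametrization avoids almost
  everywhere. The parameter 0 is sent to the origin, off the hyperbola, but is a null set.\<close>

lemma curve_measure_AC_hyperbola:
  assumes M: "M > 0" and f: "integrable lborel f"
  shows "curve_measure (hyperbola_param M) f \<in> AC_hyperbola M"
proof -
  let ?\<mu> = "curve_measure (hyperbola_param M) f"
  have [measurable]: "f \<in> borel_measurable borel" using f by auto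
  have fst: "fst \<in> borel_measurable (borel :: (real \<times> real) measure)"
    by (intro borel_measurable_continuous_onI continuous_intros)
  have zero: "?\<mu> A = 0" if A: "AE t in lborel. hyperbola_param M t \<notin> A" for A
    unfolding curve_measure_def
    by (rule integral_eq_zero_AE) (use A in \<open>auto elim!: eventually_mono\<close>)
  have "?\<mu> A = 0" if "A \<inter> hyperbola M = {}" for A
  proof (rule zero)
    have notin: "hyperbola_param M t \<notin> A" if "t \<noteq> 0" for t
      using bij_betwE[OF hyperbola_param_bij[OF M]] \<open>A \<inter> hyperbola M = {}\<close> that by auto
    show "AE t in lborel. hyperbola_param M t \<notin> A"
      using AE_lborel_singleton[of 0] by eventually_elim (rule notin)
  qed
  moreover have "?\<mu> A = 0" if "A \<in> null_sets (hyperbola_arc_length M)" for A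
    using hyperbola_arc_length_null_sets[OF that] by (rule zero)
  ultimately show ?thesis
    unfolding AC_hyperbola_def
    using complex_measure_curve_measure[OF hyperbola_param_measurable fst fst_hyperbola_param f]
    by blast
qed

lemma Lambda_mm_conv_pp: "(x, y) \<in> Lambda_mm \<alpha> \<beta> \<longleftrightarrow> (- x, - y) \<in> Lambda_pp \<alpha> \<beta>"
proof -
  have flip: "(\<exists>j::int. z = \<gamma> * of_int j \<and> P j) \<longleftrightarrow> (\<exists>j::int. - z = \<gamma> * of_int j \<and> P (- j))" for z \<gamma> :: real and P
  proof
    assume "\<exists>j::int. z = \<gamma> * of_int j \<and> P j"
    then obtain j :: int where "z = \<gamma> * of_int j" "P j" by blast
    then show "\<exists>j::int. - z = \<gamma> * of_int j \<and> P (- j)" by (intro exI[of _ "- j"]) simp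
  next
    assume "\<exists>j::int. - z = \<gamma> * of_int j \<and> P (- j)"
    then obtain j :: int where "- z = \<gamma> * of_int j" and P: "P (- j)" by blast
    then have "z = \<gamma> * of_int (- j)" by simp
    with P show "\<exists>j::int. z = \<gamma> * of_int j \<and> P j" by (intro exI[of _ "- j"]) simp
  qed
  show ?thesis
    using flip[of x \<alpha> "\<lambda>j. j \<le> 0"] flip[of y \<beta> "\<lambda>k. k \<le> -1"]
    by (simp add: Lambda_pp_def Lambda_mm_def)
qed

lemma zclos_eqI:
  assumes "\<And>\<xi>. \<xi> \<notin> \<Lambda> \<Longrightarrow> \<exists>\<mu>\<in>AC_hyperbola M. (\<forall>\<eta>\<in>\<Lambda>. fourier \<mu> \<eta> = 0) \<and> fourier \<mu> \<xi> \<noteq> 0"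
  shows "zclos M \<Lambda> = \<Lambda>"
  using assms unfolding zclos_def by blast

theorem theorem1p8p1:
  fixes \<alpha> \<beta> M :: real
  assumes "\<alpha> > 0" and "\<beta> > 0" and "M > 0"
  shows "(\<forall>\<xi>s. \<xi>s \<notin> Lambda_pp \<alpha> \<beta> \<longrightarrow>
            (\<exists>\<mu> \<in> AC_hyperbola M. (\<forall>\<xi> \<in> Lambda_pp \<alpha> \<beta>. fourier \<mu> \<xi> = 0) \<and> fourier \<mu> \<xi>s \<noteq> 0)) \<and>
         (\<forall>\<xi>s. \<xi>s \<notin> Lambda_mm \<alpha> \<beta> \<longrightarrow>
            (\<exists>\<mu> \<in> AC_hyperbola M. (\<forall>\<xi> \<in> Lambda_mm \<alpha> \<beta>. fourier \<mu> \<xi> = 0) \<and> fourier \<mu> \<xi>s \<noteq> 0)) \<and>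
         zclos M (Lambda_pp \<alpha> \<beta>) = Lambda_pp \<alpha> \<beta> \<and>
         zclos M (Lambda_mm \<alpha> \<beta>) = Lambda_mm \<alpha> \<beta>"
proof -
  let ?c = "M\<^sup>2 / (4 * pi\<^sup>2)"
  have c: "?c > 0" using assms(3) by simp
  have pp: "\<exists>\<mu>\<in>AC_hyperbola M. (\<forall>\<xi>\<in>Lambda_pp \<alpha> \<beta>. fourier \<mu> \<xi> = 0) \<and> fourier \<mu> \<xi>s \<noteq> 0"
    if "\<xi>s \<notin> Lambda_pp \<alpha> \<beta>" for \<xi>s
  proof -
    obtain x y where xy: "\<xi>s = (x, y)" by (cases \<xi>s)
    obtain f where f: "integrable lborel f"
      "\<And>a b. (a, b) \<in> Lambda_pp \<alpha> \<beta> \<Longrightarrow> wave_transform f (pi * a) (?c * (pi * b)) = 0"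
      "wave_transform f (pi * x) (?c * (pi * y)) \<noteq> 0"
      using cross_annihilator_exists[OF assms(1,2) c, of x y] \<open>\<xi>s \<notin> _\<close> xy by blast
    show ?thesis
      using f curve_measure_AC_hyperbola[OF assms(3) f(1)]
      by (intro bexI[of _ "curve_measure (hyperbola_param M) f"])
         (auto simp: xy fourier_curve_measure[OF f(1)])
  qed
  have mm: "\<exists>\<mu>\<in>AC_hyperbola M. (\<forall>\<xi>\<in>Lambda_mm \<alpha> \<beta>. fourier \<mu> \<xi> = 0) \<and> fourier \<mu> \<xi>s \<noteq> 0"
    if "\<xi>s \<notin> Lambda_mm \<alpha> \<beta>" for \<xi>s
  proof -
    obtain x y where xy: "\<xi>s = (x, y)" by (cases \<xi>s)
    have "(- x, - y) \<notin> Lambda_pp \<alpha> \<beta>" using that by (simp add: xy Lambda_mm_conv_pp)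
    then obtain f where f: "integrable lborel f"
      "\<And>a b. (a, b) \<in> Lambda_pp \<alpha> \<beta> \<Longrightarrow> wave_transform f (pi * a) (?c * (pi * b)) = 0"
      "wave_transform f (pi * - x) (?c * (pi * - y)) \<noteq> 0"
      using cross_annihilator_exists[OF assms(1,2) c, of "- x" "- y"] by blast
    \<comment> \<open>The density reflected in 0 has its transform reflected in the origin, which
      carries the annihilator for (-x, -y) over to the opposite cross.\<close>
    note g = wave_transform_reflection[OF f(1)]
    have "wave_transform f (- (pi * a)) (- (?c * (pi * b))) = 0" if "(a, b) \<in> Lambda_mm \<alpha> \<beta>" for a b
      using f(2)[of "- a" "- b"] that by (simp add: Lambda_mm_conv_pp)
    then show ?thesis
      using f(3) curve_measure_AC_hyperbola[OF assms(3) g(1)]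
      by (intro bexI[of _ "curve_measure (hyperbola_param M) (\<lambda>t. f (- t))"])
         (auto simp: xy fourier_curve_measure[OF g(1)] g(2))
  qed
  show ?thesis
    using pp mm zclos_eqI[OF pp] zclos_eqI[OF mm] by blast
qed

end
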